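(* Let $n\ge 1$ and let ${\boldsymbol{\alpha}}=(\alpha_2,\alpha_3,\ldots)$ be a sequence of nonnegative integers with finitely many nonzero entries and $\sum_{j\ge2}(j-1)\alpha_j=n-1$. Then the equivalence classes of minimal factorizations of type ${\boldsymbol{\alpha}}$ of the $n$-cycle $(1\,2\,\ldots\,n)$ are in one-to-one correspondence with undirected rooted plane trees having exactly $\alpha_j$ vertices of degree $2j$ for each $j\ge 2$ and $2n$ leaves (vertices of degree $1$), and no other vertices.
   Context: Permutations are multiplied right to left: in a product $\sigma_m\cdots\sigma_1$ the factor $\sigma_1$ is applied first. A factorization of the cycle $(1\,2\,\ldots\,n)$ is an expression $(1\,2\,\ldots\,n)=\sigma_m\cdots\sigma_1$ where each $\sigma_i$ is a cycle of length at least $2$. It is of type ${\boldsymbol{\alpha}}=(\alpha_2,\alpha_3,\ldots)$ if exactly $\alpha_j$ of the factors are $j$-cycles. One always has $\sum_{j\ge2}(j-1)\alpha_j\ge n-1$, and the factorization is called minimal if equality holds. Two factorizations are equivalent if one can be obtained from the other by repeatedly swapping adjacent commuting factors (i.e. they differ only in the order of commuting factors). In the trees, the root is one of the leaves, and the plane structure means the cyclic order of edges around each vertex is part of the data. *)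

theory Defs
  imports "HOL-Combinatorics.Cycles" "HOL-Library.Multiset"
begin

definition is_cycle_of_len :: "nat \<Rightarrow> nat \<Rightarrow> (nat \<Rightarrow> nat) \<Rightarrow> bool" where
  "is_cycle_of_len n j f \<longleftrightarrow>
     (\<exists>cs. distinct cs \<and> length cs = j \<and> set cs \<subseteq> {1..n} \<and> f = cycle_of_list cs)"

definition long_cycle :: "nat \<Rightarrow> nat \<Rightarrow> nat" where
  "long_cycle n = cycle_of_list [1..<n+1]"

(* The list [s_m, ..., s_1] represents the product s_m \<circ> ... \<circ> s_1 (s_1 applied first). *)
definition list_prod :: "(nat \<Rightarrow> nat) list \<Rightarrow> nat \<Rightarrow> nat" where
  "list_prod fs = foldr (\<circ>) fs id"

definition factorizations :: "nat \<Rightarrow> (nat \<Rightarrow> nat) \<Rightarrow> (nat \<Rightarrow> nat) list set" where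
  "factorizations n \<alpha> =
     {fs. (\<forall>f\<in>set fs. \<exists>j\<ge>2. is_cycle_of_len n j f)
        \<and> list_prod fs = long_cycle n
        \<and> (\<forall>j\<ge>2. length (filter (is_cycle_of_len n j) fs) = \<alpha> j)}"

definition comm_swap :: "((nat \<Rightarrow> nat) list \<times> (nat \<Rightarrow> nat) list) set" where
  "comm_swap = {(as @ [a, b] @ bs, as @ [b, a] @ bs) | as a b bs. a \<circ> b = b \<circ> a}"

definition fact_equiv :: "((nat \<Rightarrow> nat) list \<times> (nat \<Rightarrow> nat) list) set" where
  "fact_equiv = comm_swap\<^sup>*"

datatype ptree = Node "ptree list"

(* multiset of degrees of the non-root vertices of a subtree (each has a parent edge) *)
fun degs_below :: "ptree \<Rightarrow> nat multiset" where
  "degs_below (Node ts) = {# length ts + 1 #} + sum_list (map degs_below ts)"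

fun tree_degs :: "ptree \<Rightarrow> nat multiset" where
  "tree_degs (Node ts) = {# length ts #} + sum_list (map degs_below ts)"

definition trees_of_type :: "nat \<Rightarrow> (nat \<Rightarrow> nat) \<Rightarrow> ptree set" where
  "trees_of_type n \<alpha> =
     {T. (\<exists>t. T = Node [t])
       \<and> count (tree_degs T) 1 = 2 * n
       \<and> (\<forall>j\<ge>2. count (tree_degs T) (2 * j) = \<alpha> j)
       \<and> (\<forall>d\<in>#tree_degs T. d = 1 \<or> (\<exists>j\<ge>2. d = 2 * j))}"

end

theory Submission
  imports Defs
begin

text \<open>
  Draw every factor of a minimal factorization as a polygon on the points that it moves. Minimality
  makes the polygons a plane hypertree, so removing one polygon \<open>(a\<^sub>1 \<dots> a\<^sub>j)\<close> leaves \<open>j\<close> components,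
  one at each \<open>a\<^sub>i\<close>. Take for the polygon the last applied factor moving a chosen root \<open>a\<^sub>1\<close>. At
  \<open>a\<^sub>i\<close> the remaining factors split further into those that must be applied after the polygon and those
  that must be applied before it; the former are absent at \<open>a\<^sub>1\<close>. Up to commutation this leaves
  \<open>2j - 1\<close> smaller minimal factorizations of cycles, which are the subtrees of a vertex of degree
  \<open>2j\<close>. Conversely the set of factors alone determines the root polygon and the \<open>2j - 1\<close> parts.
\<close>

section \<open>Commutation equivalence\<close>

text \<open>A commutation class has no preferred word, and the root polygon may sit anywhere inside
  a word; deleting an inner factor does not show directly which of the others must stay before it
  and which after. The leftmost factor is easier: nothing is applied after it, so each of its points
  carries only a "before" part. Existence is therefore proved by peeling off the leftmost factor
  together with everything hanging at its points, except the one leading towards the root, and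
  grafting this star back onto a shorter factorization that is already split. In the other direction
  no normal form is needed. Each factor moves at least two points while two parts share at most one,
  so moved sets decide to which part a factor belongs, and the set of factors is invariant under
  commutation. Point sets are kept as lists in cyclic order starting at the root point, because a
  part lives on an arbitrary subset and inherits its order; cutting out a subtree is then cutting
  the list.\<close>

abbreviation fact_equiv_infix :: "(nat \<Rightarrow> nat) list \<Rightarrow> (nat \<Rightarrow> nat) list \<Rightarrow> bool" (infix "\<sim>" 50) where
  "fs \<sim> gs \<equiv> (fs, gs) \<in> fact_equiv"

lemma fact_equiv_refl [simp]: "fs \<sim> fs"
  by (simp add: fact_equiv_def)

lemma fact_equiv_trans [trans]: "fs \<sim> gs \<Longrightarrow> gs \<sim> hs \<Longrightarrow> fs \<sim> hs"
  by (auto simp: fact_equiv_def)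

lemma comm_swap_sym: "(fs, gs) \<in> comm_swap \<Longrightarrow> (gs, fs) \<in> comm_swap"
  unfolding comm_swap_def by fastforce

lemma fact_equiv_sym: "fs \<sim> gs \<Longrightarrow> gs \<sim> fs"
proof -
  have "sym comm_swap"
    by (rule symI) (rule comm_swap_sym)
  then show "fs \<sim> gs \<Longrightarrow> gs \<sim> fs"
    unfolding fact_equiv_def by (meson sym_rtrancl symD)
qed

lemma equiv_fact_equiv: "equiv UNIV fact_equiv"
proof (rule equivI)
  show "fact_equiv \<subseteq> UNIV \<times> UNIV"
    by simp
  show "refl fact_equiv"
    by (rule refl_onI) simp
  show "sym fact_equiv"
    by (rule symI) (rule fact_equiv_sym)
  show "trans fact_equiv"
    by (rule transI) (rule fact_equiv_trans)
qed

lemma comm_swap_context: "(fs, gs) \<in> comm_swap \<Longrightarrow> (us @ fs @ vs, us @ gs @ vs) \<in> comm_swap"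
proof -
  assume "(fs, gs) \<in> comm_swap"
  then obtain as a b bs where "fs = as @ [a, b] @ bs" "gs = as @ [b, a] @ bs" "a \<circ> b = b \<circ> a"
    by (auto simp: comm_swap_def)
  then have "us @ fs @ vs = (us @ as) @ [a, b] @ (bs @ vs)" "us @ gs @ vs = (us @ as) @ [b, a] @ (bs @ vs)"
    by simp_all
  with \<open>a \<circ> b = b \<circ> a\<close> show ?thesis
    unfolding comm_swap_def by blast
qed

lemma fact_equiv_context: "fs \<sim> gs \<Longrightarrow> us @ fs @ vs \<sim> us @ gs @ vs"
  unfolding fact_equiv_def
proof (induction rule: rtrancl_induct)
  case (step y z)
  then show ?case
    by (meson comm_swap_context rtrancl.rtrancl_into_rtrancl)
qed simp

lemma fact_equiv_append:
  assumes "fs \<sim> fs'" "gs \<sim> gs'"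
  shows "fs @ gs \<sim> fs' @ gs'"
  using fact_equiv_trans[OF fact_equiv_context[OF assms(1), of "[]" gs], of "fs' @ gs'"]
    fact_equiv_context[OF assms(2), of fs' "[]"]
  by simp

lemma fact_equiv_Cons: "fs \<sim> fs' \<Longrightarrow> f # fs \<sim> f # fs'"
  using fact_equiv_append[of "[f]" "[f]" fs fs'] by simp

lemma fact_equiv_move:
  assumes "\<And>g. g \<in> set gs \<Longrightarrow> f \<circ> g = g \<circ> f"
  shows "f # gs \<sim> gs @ [f]"
  using assms
proof (induction gs)
  case (Cons g gs)
  have "(f # g # gs, g # f # gs) \<in> comm_swap"
    unfolding comm_swap_def using Cons.prems[of g] append_Nil[of "[f, g] @ gs"]
    by (metis (mono_tags, lifting) append_Cons append_Nil list.set_intros(1) mem_Collect_eq)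
  then have "f # g # gs \<sim> g # f # gs"
    by (simp add: fact_equiv_def r_into_rtrancl)
  also have "g # f # gs \<sim> g # gs @ [f]"
    using Cons by (intro fact_equiv_Cons) auto
  finally show ?case by simp
qed simp

lemma fact_equiv_commute:
  assumes "\<And>f g. f \<in> set fs \<Longrightarrow> g \<in> set gs \<Longrightarrow> f \<circ> g = g \<circ> f"
  shows "fs @ gs \<sim> gs @ fs"
  using assms
proof (induction fs)
  case (Cons f fs)
  have "f # fs @ gs \<sim> f # gs @ fs"
    using Cons by (intro fact_equiv_Cons) auto
  also have "f # gs @ fs \<sim> gs @ f # fs"
  proof -
    have "f # gs \<sim> gs @ [f]"
      by (rule fact_equiv_move, rule Cons.prems) auto
    from fact_equiv_append[OF this fact_equiv_refl[of fs]] show ?thesis by simp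
  qed
  finally show ?case by simp
qed simp

text \<open>Used to separate unions of connected components. The order inside each group is
  untouched, so only pairs taken from different groups have to commute.\<close>

lemma fact_equiv_filter:
  assumes "\<And>f g. f \<in> set fs \<Longrightarrow> g \<in> set fs \<Longrightarrow> P f \<Longrightarrow> \<not> P g \<Longrightarrow> f \<circ> g = g \<circ> f"
  shows "fs \<sim> filter (\<lambda>f. \<not> P f) fs @ filter P fs"
  using assms
proof (induction fs)
  case (Cons f fs)
  have IH: "f # fs \<sim> f # filter (\<lambda>f. \<not> P f) fs @ filter P fs"
    using Cons by (intro fact_equiv_Cons) auto
  show ?case
  proof (cases "P f")
    case True
    have "f # filter (\<lambda>f. \<not> P f) fs \<sim> filter (\<lambda>f. \<not> P f) fs @ [f]"
      by (rule fact_equiv_move, rule Cons.prems) (use True in auto)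
    from fact_equiv_append[OF this fact_equiv_refl[of "filter P fs"]]
    have "f # filter (\<lambda>f. \<not> P f) fs @ filter P fs \<sim> filter (\<lambda>f. \<not> P f) fs @ f # filter P fs"
      by simp
    from fact_equiv_trans[OF IH this] True show ?thesis by simp
  qed (use IH in simp)
qed simp

section \<open>Products of words and the invariants of commutation\<close>

lemma list_prod_Nil [simp]: "list_prod [] = id"
  and list_prod_Cons [simp]: "list_prod (f # fs) = f \<circ> list_prod fs"
  by (simp_all add: list_prod_def)

lemma list_prod_append [simp]: "list_prod (fs @ gs) = list_prod fs \<circ> list_prod gs"
  by (induction fs) (simp_all add: comp_assoc)

lemma fact_equiv_invariants:
  assumes "fs \<sim> gs"
  shows "list_prod fs = list_prod gs" and "mset fs = mset gs"
proof -
  have "list_prod fs = list_prod gs \<and> mset fs = mset gs"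
    using assms unfolding fact_equiv_def
  proof (induction rule: rtrancl_induct)
    case (step y z)
    from step.hyps(2) obtain as a b bs where
      "y = as @ [a, b] @ bs" "z = as @ [b, a] @ bs" and ab: "a \<circ> b = b \<circ> a"
      by (auto simp: comm_swap_def)
    moreover have "a \<circ> (b \<circ> list_prod bs) = b \<circ> (a \<circ> list_prod bs)"
      using ab by (metis comp_assoc)
    ultimately show ?case
      using step.IH by simp
  qed simp
  then show "list_prod fs = list_prod gs" "mset fs = mset gs"
    by simp_all
qed

section \<open>Cycles given by lists\<close>

abbreviation cyc :: "'a list \<Rightarrow> 'a \<Rightarrow> 'a" where
  "cyc \<equiv> cycle_of_list"

definition moved :: "('a \<Rightarrow> 'a) \<Rightarrow> 'a set" where
  "moved f = {x. f x \<noteq> x}"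

section \<open>Joining two cycles at a common point\<close>

lemma cyc_append_commute: "distinct (u @ v) \<Longrightarrow> cyc (u @ v) = cyc (v @ u)"
  using cycle_of_list_rotate_independent[of "u @ v" "length u"] by (simp add: rotate_append)

text \<open>The right factor acts first, so \<open>ys\<close> is run through before
  \<open>xs\<close>. In the induction the leading transposition of \<open>a\<close> and
  \<open>y\<close> in the right factor is moved to the front by conjugation; this turns
  \<open>a\<close> into \<open>y\<close> in the left factor, and the induction hypothesis applies at
  \<open>y\<close>.\<close>

lemma cyc_merge:
  assumes "distinct (a # ys @ xs)"
  shows "cyc (a # xs) \<circ> cyc (a # ys) = cyc (a # ys @ xs)"
  using assms
proof (induction ys arbitrary: a)
  case (Cons y ys)
  let ?t = "transpose a y"
  have "map ?t (y # xs) = a # xs"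
    using Cons.prems by (auto intro!: map_idI simp: transpose_def)
  moreover have "?t \<circ> cyc (y # xs) \<circ> inv ?t = cyc (map ?t (y # xs))"
    using Cons.prems by (intro conjugation_of_cycle) auto
  ultimately have "?t \<circ> cyc (y # xs) \<circ> ?t = cyc (a # xs)"
    by simp
  then have "cyc (a # xs) \<circ> ?t = ?t \<circ> cyc (y # xs)"
    by (metis comp_assoc comp_id transpose_comp_involutory)
  moreover have "cyc (y # xs) \<circ> cyc (y # ys) = cyc (y # ys @ xs)"
    by (rule Cons.IH) (use Cons.prems in simp)
  ultimately show ?case
    by (metis append_Cons comp_assoc cycle_of_list.simps(1))
qed simp

text \<open>A factor on the right acts before the big cycle, so the detour \<open>Y\<close> is made
  on leaving \<open>a\<close>. Together with the mirror image for left factors, whose detour is made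
  on arriving at \<open>a\<close>, this is why blocks have the shape
  \<open>Z @ a # Y\<close>.\<close>

lemma cyc_insert_after:
  assumes "distinct (u @ a # Y @ v)"
  shows "cyc (u @ a # v) \<circ> cyc (a # Y) = cyc (u @ a # Y @ v)"
proof -
  have "cyc (u @ a # v) = cyc (a # v @ u)" "cyc (u @ a # Y @ v) = cyc (a # Y @ v @ u)"
    using cyc_append_commute[of u "a # v"] cyc_append_commute[of u "a # Y @ v"] assms by auto
  then show ?thesis
    using cyc_merge[of a Y "v @ u"] assms by auto
qed

lemma cyc_insert_before:
  assumes "distinct (u @ Z @ a # v)"
  shows "cyc (a # Z) \<circ> cyc (u @ a # v) = cyc (u @ Z @ a # v)"
proof -
  have "cyc (u @ a # v) = cyc (a # v @ u)" "cyc (u @ Z @ a # v) = cyc (a # v @ u @ Z)"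
    using cyc_append_commute[of u "a # v"] cyc_append_commute[of "u @ Z" "a # v"] assms by auto
  then show ?thesis
    using cyc_merge[of a "v @ u" Z] assms by auto
qed

section \<open>Supports, orbits and recovery of the list from its cycle\<close>

lemma cyc_nth:
  assumes "distinct xs" "i < length xs"
  shows "cyc xs (xs ! i) = xs ! (Suc i mod length xs)"
proof -
  have "map (cyc xs) xs ! i = rotate 1 xs ! i"
    using cyclic_rotation[OF assms(1), of 1] by simp
  then show ?thesis
    using assms(2) by (simp add: nth_rotate del: rotate_Suc One_nat_def) simp
qed

lemma cyc_next:
  assumes "distinct xs" "Suc i < length xs"
  shows "cyc xs (xs ! i) = xs ! Suc i"
  using cyc_nth[of xs i] assms by simp

lemma moved_cyc_subset: "moved (cyc xs) \<subseteq> set xs"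
  using id_outside_supp[of _ xs] by (auto simp: moved_def)

lemma moved_cyc:
  assumes "distinct xs" "2 \<le> length xs"
  shows "moved (cyc xs) = set xs"
proof -
  have "cyc xs x \<noteq> x" if x: "x \<in> set xs" for x
  proof -
    obtain i where i: "i < length xs" "x = xs ! i"
      using x unfolding in_set_conv_nth by blast
    have "Suc i mod length xs \<noteq> i" "Suc i mod length xs < length xs"
      using i(1) assms(2) by (auto simp: mod_Suc)
    then show ?thesis
      using cyc_nth[OF assms(1) i(1)] i assms(1) by (simp add: nth_eq_iff_index_eq)
  qed
  with moved_cyc_subset[of xs] show ?thesis
    by (auto simp: moved_def)
qed

text \<open>Fixing the first entry removes the rotational freedom: the i-th entry is the i-th
  iterate of \<open>r\<close>. Of two different lengths the shorter one would bring \<open>r\<close>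
  back too early for the longer list.\<close>

lemma cyc_inject:
  assumes "distinct (r # u)" "distinct (r # v)" "cyc (r # u) = cyc (r # v)"
  shows "u = v"
proof -
  have iter: "(cyc xs ^^ i) (hd xs) = xs ! i" if "distinct xs" "i < length xs" for xs :: "'a list" and i
    using that
  proof (induction i)
    case 0
    then show ?case by (simp add: hd_conv_nth)
  next
    case (Suc i)
    then show ?case by (simp add: cyc_next)
  qed
  have le: "length v \<le> length u" if d: "distinct (r # u)" "distinct (r # v)" and e: "cyc (r # u) = cyc (r # v)" for u v
  proof (rule ccontr)
    assume "\<not> length v \<le> length u"
    moreover have "(cyc (r # u) ^^ length (r # u)) r = r"
      using cycle_is_id_root[OF d(1)] by (metis id_apply)
    ultimately show False
      using iter[OF d(2), of "length (r # u)"] d(2) e nth_mem[of "length u" v] by (auto simp del: funpow.simps)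
  qed
  have "length u = length v"
    using le[OF assms] le[OF assms(2,1) assms(3)[symmetric]] by simp
  then have "r # u = r # v"
    using iter[OF assms(1)] iter[OF assms(2)] assms(3) by (intro nth_equalityI) auto
  then show ?thesis by simp
qed

text \<open>The support of a cycle is a single orbit. Connectivity arguments use this with
  \<open>S\<close> a union of components.\<close>

lemma cyc_transitive:
  assumes "distinct xs" "x \<in> set xs" "x \<in> S" "\<And>y. y \<in> S \<Longrightarrow> cyc xs y \<in> S"
  shows "set xs \<subseteq> S"
proof
  fix y assume "y \<in> set xs"
  obtain i where i: "i < length xs" "x = xs ! i"
    using assms(2) unfolding in_set_conv_nth by blast
  have pow: "(cyc xs ^^ k) x \<in> S" for k
    by (induction k) (auto simp: assms)
  obtain j where j: "j < length xs" "y = rotate i xs ! j"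
    using \<open>y \<in> set xs\<close> by (metis in_set_conv_nth length_rotate set_rotate)
  have "map (cyc xs ^^ j) xs ! i = rotate j xs ! i"
    using cyclic_rotation[OF assms(1), of j] by simp
  then have "(cyc xs ^^ j) x = y"
    using i j by (simp add: nth_rotate add.commute)
  with pow show "y \<in> S" by blast
qed

lemma cyc_of_transitive:
  assumes "p permutes K" "finite K" "c \<in> K" "\<And>x. x \<in> K \<Longrightarrow> x \<in> range (\<lambda>i. (p ^^ i) c)"
  obtains Y where "distinct (c # Y)" "set (c # Y) = K" "p = cyc (c # Y)"
proof -
  have perm: "permutation p"
    using assms(1,2) permutation_permutes by blast
  have pos: "least_power p c > 0"
    by (rule least_power_of_permutation[OF perm])
  \<comment> \<open>\<open>support p c\<close> lists the iterates of \<open>c\<close> up to the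
    first return; since this period is positive, \<open>c\<close> is its head.\<close>
  then have hd: "support p c = c # tl (support p c)"
    by (simp add: upt_rec)
  have "(p ^^ i) c \<in> K" for i
    using permutes_in_image[OF permutes_funpow[OF assms(1)]] assms(3) by blast
  with assms(4) have "range (\<lambda>i. (p ^^ i) c) = K"
    by blast
  then have set: "set (support p c) = K"
    using support_set[OF perm, of c] by simp
  have "p = cyc (support p c)"
  proof
    fix x
    show "p x = cyc (support p c) x"
    proof (cases "x \<in> K")
      case True
      then show ?thesis using cycle_restrict[OF perm, of x c] set by simp
    next
      case False
      then show ?thesis
        using set id_outside_supp[of x "support p c"] permutes_not_in[OF assms(1)] by simp
    qed
  qed
  with hd set cycle_of_permutation[OF perm, of c] show ?thesis
    by (intro that[of "tl (support p c)"]) simp_all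
qed

section \<open>Minimal factorizations of a cycle\<close>

definition cycle_on :: "'a set \<Rightarrow> ('a \<Rightarrow> 'a) \<Rightarrow> bool" where
  "cycle_on V f \<longleftrightarrow> (\<exists>cs. distinct cs \<and> 2 \<le> length cs \<and> set cs \<subseteq> V \<and> f = cyc cs)"

lemma cycle_onE:
  assumes "cycle_on V f"
  obtains cs where "distinct cs" "2 \<le> length cs" "set cs \<subseteq> V" "f = cyc cs" "moved f = set cs"
  using assms moved_cyc unfolding cycle_on_def by metis

lemma cycle_on_cyc: "distinct cs \<Longrightarrow> 2 \<le> length cs \<Longrightarrow> set cs \<subseteq> V \<Longrightarrow> cycle_on V (cyc cs)"
  unfolding cycle_on_def by blast

lemma cycle_on_permutes:
  assumes "cycle_on V f"
  shows "f permutes V"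
  using assms by (elim cycle_onE) (metis cycle_permutes permutes_subset)

lemma cycle_on_moved:
  assumes "cycle_on V f"
  shows "moved f \<subseteq> V" "finite (moved f)" "2 \<le> card (moved f)"
  using assms by (elim cycle_onE; simp add: distinct_card)+

lemma cycle_on_subset:
  assumes "cycle_on V f" "moved f \<subseteq> W"
  shows "cycle_on W f"
  using assms by (elim cycle_onE) (simp add: cycle_on_cyc)

lemma cycle_on_mono: "cycle_on V f \<Longrightarrow> V \<subseteq> W \<Longrightarrow> cycle_on W f"
  using cycle_on_subset cycle_on_moved(1) by (metis order_trans)

lemma cycle_on_commute:
  assumes "cycle_on V f" "cycle_on W g" "moved f \<inter> moved g = {}"
  shows "f \<circ> g = g \<circ> f"
  using assms by (elim cycle_onE) (metis cycles_commute)

lemma cycle_on_commute_disjoint: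
  assumes "cycle_on V f" "cycle_on W g" "V \<inter> W = {}"
  shows "f \<circ> g = g \<circ> f"
  using assms cycle_on_moved(1) by (intro cycle_on_commute[OF assms(1,2)]) fast

text \<open>The left side of the minimality condition, the sum of (j-1)\<alpha>_j: a j-cycle is
  recognised by moving exactly j points.\<close>

definition weight :: "('a \<Rightarrow> 'a) list \<Rightarrow> nat" where
  "weight fs = (\<Sum>f\<leftarrow>fs. card (moved f) - 1)"

lemma weight_simps [simp]:
  "weight [] = 0"
  "weight (f # fs) = (card (moved f) - 1) + weight fs"
  "weight (fs @ gs) = weight fs + weight gs"
  by (simp_all add: weight_def)

text \<open>The \<open>Suc\<close> avoids truncated subtraction and excludes the empty list. On one
  point only the empty word qualifies; it becomes a leaf.\<close>

definition min_fact :: "nat list \<Rightarrow> (nat \<Rightarrow> nat) list \<Rightarrow> bool" where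
  "min_fact xs fs \<longleftrightarrow> distinct xs \<and> (\<forall>f\<in>set fs. cycle_on (set xs) f)
     \<and> list_prod fs = cyc xs \<and> Suc (weight fs) = length xs"

lemma min_fact_rotate:
  assumes "min_fact (u @ v) fs"
  shows "min_fact (v @ u) fs"
  using assms cyc_append_commute[of u v] unfolding min_fact_def by (auto simp: Un_commute)

lemma min_fact_singleton: "min_fact [x] []"
  by (simp add: min_fact_def)

lemma min_fact_length:
  assumes "min_fact xs fs"
  shows "length fs < length xs"
proof -
  have "length fs \<le> weight fs" if "\<forall>f\<in>set fs. cycle_on V f" for V
    using that
  proof (induction fs)
    case (Cons f fs)
    then show ?case using cycle_on_moved(3)[of V f] by simp
  qed simp
  with assms show ?thesis
    unfolding min_fact_def by (metis le_imp_less_Suc)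
qed

text \<open>The two point lists share only \<open>d\<close>, so weights add up correctly; as
  \<open>G\<close> stands on the left, \<open>E\<close> enters directly before
  \<open>d\<close>.\<close>

lemma min_fact_graft:
  assumes "min_fact (u @ d # v) H" "min_fact (d # E) G" "distinct (u @ E @ d # v)"
  shows "min_fact (u @ E @ d # v) (G @ H)"
  using assms cyc_insert_before[OF assms(3)] unfolding min_fact_def
  by (auto intro: cycle_on_mono)

text \<open>
  The decomposition of \<^term>\<open>xs\<close> into blocks \<^term>\<open>Z @ a # Y\<close>, where the points \<^term>\<open>a\<close> form
  \<^term>\<open>ps\<close>, and of a factorization of the cycle along \<^term>\<open>xs\<close> into the part \<^term>\<open>As\<close> applied
  after and the part \<^term>\<open>Bs\<close> applied before the factor with cycle list \<^term>\<open>ps\<close>.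
\<close>

inductive decomp :: "nat list \<Rightarrow> (nat \<Rightarrow> nat) list \<Rightarrow> nat list \<Rightarrow> (nat \<Rightarrow> nat) list \<Rightarrow> bool" where
  decomp_Nil: "decomp [] [] [] []"
| decomp_Cons: "min_fact (a # Z) \<alpha> \<Longrightarrow> min_fact (a # Y) \<beta> \<Longrightarrow> decomp xs As ps Bs \<Longrightarrow>
    distinct (Z @ a # Y @ xs) \<Longrightarrow> decomp (Z @ a # Y @ xs) (\<alpha> @ As) (a # ps) (Bs @ \<beta>)"

lemma decomp_distinct: "decomp xs As ps Bs \<Longrightarrow> distinct xs"
  by (cases rule: decomp.cases) auto

lemma decomp_points: "decomp xs As ps Bs \<Longrightarrow> set ps \<subseteq> set xs \<and> distinct ps \<and> (ps = [] \<longleftrightarrow> xs = [])"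
  by (induction rule: decomp.induct) auto

lemma decomp_cycle_on:
  assumes "decomp xs As ps Bs" "f \<in> set As \<union> set Bs"
  shows "cycle_on (set xs) f"
  using assms
proof (induction rule: decomp.induct)
  case (decomp_Cons a Z \<alpha> Y \<beta> xs As ps Bs)
  from decomp_Cons.prems consider "f \<in> set \<alpha>" | "f \<in> set \<beta>" | "f \<in> set As \<union> set Bs"
    by auto
  then show ?case
  proof cases
    case 1
    with decomp_Cons.hyps(1) have "cycle_on (set (a # Z)) f"
      by (simp add: min_fact_def)
    then show ?thesis by (rule cycle_on_mono) auto
  next
    case 2
    with decomp_Cons.hyps(2) have "cycle_on (set (a # Y)) f"
      by (simp add: min_fact_def)
    then show ?thesis by (rule cycle_on_mono) auto
  next
    case 3
    from decomp_Cons.IH[OF this] show ?thesis by (rule cycle_on_mono) auto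
  qed
qed simp

lemma decomp_weight: "decomp xs As ps Bs \<Longrightarrow> weight As + weight Bs + length ps = length xs"
  by (induction rule: decomp.induct) (auto simp: min_fact_def)

text \<open>The prefix \<open>u\<close> holds the polygon points already treated, so that the
  induction can move \<open>a\<close> into it. The innermost words collapse first; \<alpha> and
  \<beta> then insert \<open>Z\<close> before and \<open>Y\<close> after \<open>a\<close>.\<close>

lemma decomp_prod:
  assumes "decomp xs As ps Bs" "distinct (u @ xs)"
  shows "list_prod As \<circ> cyc (u @ ps) \<circ> list_prod Bs = cyc (u @ xs)"
  using assms
proof (induction arbitrary: u rule: decomp.induct)
  case (decomp_Cons a Z \<alpha> Y \<beta> xs As ps Bs)
  have \<alpha>: "list_prod \<alpha> = cyc (a # Z)" and \<beta>: "list_prod \<beta> = cyc (a # Y)"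
    using decomp_Cons.hyps(1,2) by (simp_all add: min_fact_def)
  have "list_prod As \<circ> cyc ((u @ [a]) @ ps) \<circ> list_prod Bs = cyc ((u @ [a]) @ xs)"
    by (rule decomp_Cons.IH) (use decomp_Cons.prems in auto)
  then have "list_prod (\<alpha> @ As) \<circ> cyc (u @ a # ps) \<circ> list_prod (Bs @ \<beta>)
      = cyc (a # Z) \<circ> cyc (u @ a # xs) \<circ> cyc (a # Y)"
    by (simp add: \<alpha> \<beta> fun_eq_iff)
  also have "\<dots> = cyc ((u @ Z) @ a # xs) \<circ> cyc (a # Y)"
    by (subst cyc_insert_before) (use decomp_Cons.prems in auto)
  also have "\<dots> = cyc ((u @ Z) @ a # Y @ xs)"
    using decomp_Cons.prems by (intro cyc_insert_after) auto
  finally show ?case by (simp only: append_assoc append_Cons)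
qed simp

text \<open>\<open>decomp_prod\<close> with prefix \<open>[r]\<close> yields the cycle on
  \<open>r # xs\<close>, and \<beta> inserts \<open>Y\<close> after \<open>r\<close>. Nothing is
  inserted before \<open>r\<close>, since no factor left of the root cycle moves
  \<open>r\<close>.\<close>

lemma min_fact_of_decomp:
  assumes "decomp xs As ps Bs" "xs \<noteq> []" "min_fact (r # Y) \<beta>" "distinct (r # Y @ xs)"
  shows "min_fact (r # Y @ xs) (As @ [cyc (r # ps)] @ Bs @ \<beta>)"
proof -
  note pts = decomp_points[OF assms(1)]
  have ps: "distinct (r # ps)" "2 \<le> length (r # ps)" "set (r # ps) \<subseteq> set (r # Y @ xs)"
    using pts assms(2,4) by (auto simp: Suc_le_eq)
  have \<beta>: "list_prod \<beta> = cyc (r # Y)" "Suc (weight \<beta>) = length (r # Y)"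
    using assms(3) by (simp_all add: min_fact_def)
  have "list_prod As \<circ> cyc ([r] @ ps) \<circ> list_prod Bs = cyc ([r] @ xs)"
    using assms(4) by (intro decomp_prod[OF assms(1)]) auto
  then have "list_prod (As @ [cyc (r # ps)] @ Bs @ \<beta>) = cyc ([] @ r # xs) \<circ> cyc (r # Y)"
    by (simp add: \<beta> fun_eq_iff)
  also have "\<dots> = cyc ([] @ r # Y @ xs)"
    using assms(4) by (intro cyc_insert_after) auto
  finally have prod: "list_prod (As @ [cyc (r # ps)] @ Bs @ \<beta>) = cyc (r # Y @ xs)"
    by simp
  have "card (moved (cyc (r # ps))) = Suc (length ps)"
    using moved_cyc[OF ps(1,2)] ps(1) distinct_card by fastforce
  then have "Suc (weight (As @ [cyc (r # ps)] @ Bs @ \<beta>)) = length (r # Y @ xs)"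
    using decomp_weight[OF assms(1)] \<beta>(2) by simp
  moreover have "cycle_on (set (r # Y @ xs)) f" if f: "f \<in> set (As @ [cyc (r # ps)] @ Bs @ \<beta>)" for f
  proof -
    from f consider "f \<in> set As \<union> set Bs" | "f = cyc (r # ps)" | "f \<in> set \<beta>"
      by auto
    then show ?thesis
    proof cases
      case 1
      from decomp_cycle_on[OF assms(1) this] show ?thesis
        by (rule cycle_on_mono) auto
    next
      case 2
      then show ?thesis using ps cycle_on_cyc by blast
    next
      case 3
      with assms(3) have "cycle_on (set (r # Y)) f"
        by (simp add: min_fact_def)
      then show ?thesis by (rule cycle_on_mono) auto
    qed
  qed
  ultimately show ?thesis
    using prod assms(4) unfolding min_fact_def by blast
qed

text \<open>Grafts a last applied word \<open>G\<close> at \<open>d\<close>; \<open>M\<close> will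
  be the root cycle. Commutation with \<open>M\<close> is demanded only for \<open>d\<close> off the
  polygon: at a polygon point \<open>G\<close> shares \<open>d\<close> with the root cycle, but
  there it joins the "after" part and never has to pass \<open>M\<close>.\<close>

lemma decomp_insert:
  assumes "decomp xs As ps Bs" "min_fact (d # E) G" "xs = u @ d # v" "distinct (u @ E @ d # v)"
    and "\<And>g m. d \<notin> set ps \<Longrightarrow> g \<in> set G \<Longrightarrow> m \<in> set M \<Longrightarrow> g \<circ> m = m \<circ> g"
  shows "\<exists>As' Bs'. decomp (u @ E @ d # v) As' ps Bs' \<and> G @ As @ M @ Bs \<sim> As' @ M @ Bs'"
  using assms
proof (induction arbitrary: u v rule: decomp.induct)
  case (decomp_Cons a Z \<alpha> Y \<beta> xs As ps Bs)
  note dist = decomp_Cons.hyps(4) and eq = decomp_Cons.prems(2) and dist' = decomp_Cons.prems(3)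
  have G: "cycle_on (set (d # E)) g" if "g \<in> set G" for g
    using decomp_Cons.prems(1) that by (simp add: min_fact_def)
  have \<alpha>: "cycle_on (set (a # Z)) f" if "f \<in> set \<alpha>" for f
    using decomp_Cons.hyps(1) that by (simp add: min_fact_def)
  have distd: "distinct (u @ d # v)"
    using dist eq by metis
  have set_eq: "set u \<union> insert d (set v) = set Z \<union> insert a (set Y \<union> set xs)"
    using arg_cong[OF eq, of set] by auto
  have E_disj: "set E \<inter> (set Z \<union> insert a (set Y \<union> set xs)) = {}"
    using dist' set_eq by auto
  have "d \<notin> set u" "d \<notin> set v"
    using distd by auto
  then have uniq: "u = u' \<and> v = v'" if "u @ d # v = u' @ d # v'" for u' v'
    using append_Cons_eq_iff[of d u v u' v'] that by blast
  consider "d \<in> set Z" | "d = a" | "d \<in> set Y" | "d \<in> set xs"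
    using set_eq by auto
  then show ?case
  proof cases
    case 1
    then obtain Z' Z'' where Z: "Z = Z' @ d # Z''"
      by (meson split_list)
    with eq uniq[of Z' "Z'' @ a # Y @ xs"] have uv: "u = Z'" "v = Z'' @ a # Y @ xs"
      by auto
    have "min_fact ((a # Z') @ E @ d # Z'') (G @ \<alpha>)"
      by (rule min_fact_graft) (use decomp_Cons.hyps(1) decomp_Cons.prems(1) dist' uv Z in auto)
    then have "decomp ((Z' @ E @ d # Z'') @ a # Y @ xs) ((G @ \<alpha>) @ As) (a # ps) (Bs @ \<beta>)"
      using decomp_Cons.hyps(2,3) dist' uv by (intro decomp.decomp_Cons) auto
    then show ?thesis
      using uv by (intro exI[of _ "(G @ \<alpha>) @ As"] exI[of _ "Bs @ \<beta>"]) simp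
  next
    case 2
    with eq uniq[of Z "Y @ xs"] have uv: "u = Z" "v = Y @ xs"
      by auto
    have "min_fact ([] @ E @ a # Z) (G @ \<alpha>)"
      by (rule min_fact_graft) (use decomp_Cons.hyps(1) decomp_Cons.prems(1) dist' uv 2 in auto)
    \<comment> \<open>Grafting in front of \<open>a\<close> puts \<open>E\<close> at the end of the
      cyclic list \<open>a # Z\<close>, which inside the block is the place just before
      \<open>a\<close>.\<close>
    then have "min_fact (a # Z @ E) (G @ \<alpha>)"
      using min_fact_rotate[of E "a # Z"] by simp
    then have "decomp ((Z @ E) @ a # Y @ xs) ((G @ \<alpha>) @ As) (a # ps) (Bs @ \<beta>)"
      using decomp_Cons.hyps(2,3) dist' uv 2 by (intro decomp.decomp_Cons) auto
    then show ?thesis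
      using uv 2 by (intro exI[of _ "(G @ \<alpha>) @ As"] exI[of _ "Bs @ \<beta>"]) simp
  next
    case 3
    then obtain Y' Y'' where Y: "Y = Y' @ d # Y''"
      by (meson split_list)
    with eq uniq[of "Z @ a # Y'" "Y'' @ xs"] have uv: "u = Z @ a # Y'" "v = Y'' @ xs"
      by auto
    have "d \<notin> set (a # ps)"
      using 3 dist decomp_points[OF decomp_Cons.hyps(3)] by auto
    then have M: "g \<circ> m = m \<circ> g" if "g \<in> set G" "m \<in> set M" for g m
      using decomp_Cons.prems(4) that by blast
    \<comment> \<open>Now \<open>d\<close> hangs on the "before" side, so \<open>G\<close> must
      travel right as far as \<beta>. The factors of \<alpha>, \<open>As\<close> and
      \<open>Bs\<close> avoid the points \<open>d # E\<close>, and \<open>M\<close> is passed by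
      assumption.\<close>
    have "g \<circ> f = f \<circ> g" if g: "g \<in> set G" and f: "f \<in> set (\<alpha> @ As @ M @ Bs)" for f g
    proof -
      from f consider "f \<in> set \<alpha>" | "f \<in> set As \<union> set Bs" | "f \<in> set M"
        by auto
      then show ?thesis
      proof cases
        case 1
        show ?thesis
          by (rule cycle_on_commute_disjoint[OF G[OF g] \<alpha>[OF 1]])
            (use 3 dist E_disj in auto)
      next
        case 2
        show ?thesis
          by (rule cycle_on_commute_disjoint[OF G[OF g] decomp_cycle_on[OF decomp_Cons.hyps(3) 2]])
            (use 3 dist E_disj in auto)
      next
        case m: 3
        with M g show ?thesis by blast
      qed
    qed
    then have "G @ \<alpha> @ As @ M @ Bs \<sim> (\<alpha> @ As @ M @ Bs) @ G"
      by (rule fact_equiv_commute)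
    from fact_equiv_append[OF this fact_equiv_refl[of \<beta>]]
    have "G @ (\<alpha> @ As) @ M @ Bs @ \<beta> \<sim> (\<alpha> @ As) @ M @ Bs @ G @ \<beta>"
      by simp
    moreover have "min_fact ((a # Y') @ E @ d # Y'') (G @ \<beta>)"
      by (rule min_fact_graft) (use decomp_Cons.hyps(2) decomp_Cons.prems(1) dist' uv Y in auto)
    then have "decomp (Z @ a # (Y' @ E @ d # Y'') @ xs) (\<alpha> @ As) (a # ps) (Bs @ G @ \<beta>)"
      using decomp_Cons.hyps(1,3) dist' uv by (intro decomp.decomp_Cons) auto
    ultimately show ?thesis
      using uv by (intro exI[of _ "\<alpha> @ As"] exI[of _ "Bs @ G @ \<beta>"]) simp
  next
    case 4
    then obtain x' x'' where x: "xs = x' @ d # x''"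
      by (meson split_list)
    with eq uniq[of "Z @ a # Y @ x'" x''] have uv: "u = Z @ a # Y @ x'" "v = x''"
      by auto
    have "d \<noteq> a"
      using 4 dist by auto
    with decomp_Cons.prems(4) have comm: "g \<circ> m = m \<circ> g"
      if "d \<notin> set ps" "g \<in> set G" "m \<in> set M" for g m
      using that by (metis set_ConsD)
    have "distinct (x' @ E @ d # x'')"
      using dist' uv by auto
    then obtain As' Bs' where IH: "decomp (x' @ E @ d # x'') As' ps Bs'" "G @ As @ M @ Bs \<sim> As' @ M @ Bs'"
      using decomp_Cons.IH[OF decomp_Cons.prems(1) x _ comm] by blast
    have "g \<circ> f = f \<circ> g" if "g \<in> set G" "f \<in> set \<alpha>" for f g
      by (rule cycle_on_commute_disjoint[OF G[OF that(1)] \<alpha>[OF that(2)]])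
        (use 4 dist E_disj in auto)
    then have "G @ \<alpha> \<sim> \<alpha> @ G"
      by (rule fact_equiv_commute)
    from fact_equiv_append[OF this fact_equiv_refl[of "As @ M @ Bs @ \<beta>"]]
    have "G @ (\<alpha> @ As) @ M @ Bs @ \<beta> \<sim> \<alpha> @ (G @ As @ M @ Bs) @ \<beta>"
      by simp
    also have "\<alpha> @ (G @ As @ M @ Bs) @ \<beta> \<sim> \<alpha> @ (As' @ M @ Bs') @ \<beta>"
      using IH(2) by (rule fact_equiv_context)
    finally have "G @ (\<alpha> @ As) @ M @ Bs @ \<beta> \<sim> (\<alpha> @ As') @ M @ Bs' @ \<beta>"
      by simp
    moreover have "decomp (Z @ a # Y @ x' @ E @ d # x'') (\<alpha> @ As') (a # ps) (Bs' @ \<beta>)"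
      using decomp_Cons.hyps(1,2) IH(1) dist' uv by (intro decomp.decomp_Cons) auto
    ultimately show ?thesis
      using uv by (intro exI[of _ "\<alpha> @ As'"] exI[of _ "Bs' @ \<beta>"]) simp
  qed
qed simp

section \<open>Factorizations encoded by plane trees\<close>

text \<open>
  \<^term>\<open>rep T xs fs\<close>: the tree below the root edge is \<^term>\<open>T\<close>. The children of its top vertex are
  \<open>B\<^sub>1, A\<^sub>2, B\<^sub>2, \<dots>, A\<^sub>j, B\<^sub>j\<close>; the top vertex is the leftmost factor \<open>(a\<^sub>1 \<dots> a\<^sub>j)\<close> moving
  \<open>a\<^sub>1 = hd xs\<close>, and \<open>A\<^sub>i\<close> (\<open>B\<^sub>i\<close>) encodes the factors hanging at \<open>a\<^sub>i\<close> that are applied after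
  (before) it.
\<close>

inductive rep :: "ptree \<Rightarrow> nat list \<Rightarrow> (nat \<Rightarrow> nat) list \<Rightarrow> bool"
  and reps :: "ptree list \<Rightarrow> nat list \<Rightarrow> (nat \<Rightarrow> nat) list \<Rightarrow> nat list \<Rightarrow> (nat \<Rightarrow> nat) list \<Rightarrow> bool"
where
  rep_leaf: "rep (Node []) [x] []"
| rep_node: "rep B (r # Y) \<beta> \<Longrightarrow> reps ts xs As ps Bs \<Longrightarrow> ts \<noteq> [] \<Longrightarrow>
    rep (Node (B # ts)) (r # Y @ xs) (As @ [cyc (r # ps)] @ Bs @ \<beta>)"
| reps_Nil: "reps [] [] [] [] []"
| reps_Cons: "rep A (a # Z) \<alpha> \<Longrightarrow> rep B (a # Y) \<beta> \<Longrightarrow> reps ts xs As ps Bs \<Longrightarrow>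
    reps (A # B # ts) (Z @ a # Y @ xs) (\<alpha> @ As) (a # ps) (Bs @ \<beta>)"

lemma reps_nonempty: "reps ts xs As ps Bs \<Longrightarrow> ts \<noteq> [] \<Longrightarrow> xs \<noteq> [] \<and> ps \<noteq> []"
  by (cases rule: reps.cases) auto

lemma reps_Cons_points:
  assumes "reps ts xs As (a # ps) Bs"
  obtains A B ts\<^sub>1 Z Y xs\<^sub>1 \<alpha> \<beta> As\<^sub>1 Bs\<^sub>1 where
    "ts = A # B # ts\<^sub>1" "xs = Z @ a # Y @ xs\<^sub>1" "As = \<alpha> @ As\<^sub>1" "Bs = Bs\<^sub>1 @ \<beta>"
    "rep A (a # Z) \<alpha>" "rep B (a # Y) \<beta>" "reps ts\<^sub>1 xs\<^sub>1 As\<^sub>1 ps Bs\<^sub>1"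
  using assms by (cases rule: reps.cases) blast+

lemma rep_sound: "rep T xs fs \<Longrightarrow> distinct xs \<longrightarrow> min_fact xs fs"
  and reps_sound: "reps ts xs As ps Bs \<Longrightarrow> distinct xs \<longrightarrow> decomp xs As ps Bs"
proof (induction rule: rep_reps.inducts)
  case (rep_leaf x)
  then show ?case by (simp add: min_fact_singleton)
next
  case (rep_node B r Y \<beta> ts xs As ps Bs)
  show ?case
  proof
    assume "distinct (r # Y @ xs)"
    with rep_node reps_nonempty show "min_fact (r # Y @ xs) (As @ [cyc (r # ps)] @ Bs @ \<beta>)"
      by (intro min_fact_of_decomp) auto
  qed
next
  case reps_Nil
  then show ?case by (simp add: decomp_Nil)
next
  case (reps_Cons A a Z \<alpha> B Y \<beta> ts xs As ps Bs)
  show ?case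
  proof
    assume "distinct (Z @ a # Y @ xs)"
    with reps_Cons show "decomp (Z @ a # Y @ xs) (\<alpha> @ As) (a # ps) (Bs @ \<beta>)"
      by (intro decomp_Cons) auto
  qed
qed

section \<open>Vertex degrees of the encoding tree\<close>

abbreviation factor_degs :: "(nat \<Rightarrow> nat) list \<Rightarrow> nat multiset" where
  "factor_degs fs \<equiv> image_mset (\<lambda>f. 2 * card (moved f)) (mset fs)"

lemma replicate_mset_add: "replicate_mset (m + n) x = replicate_mset m x + replicate_mset n x"
  by (induction m) simp_all

text \<open>Each point owns two leaves, the two ends of the chain of polygons through it.
  \<open>Node [T]\<close> plants the subtree at a leaf, so that a part on k points has 2k leaves
  including its root.\<close>

lemma rep_degs: "rep T xs fs \<Longrightarrow> distinct xs \<longrightarrow>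
      tree_degs (Node [T]) = factor_degs fs + replicate_mset (2 * length xs) 1"
  and reps_degs: "reps ts xs As ps Bs \<Longrightarrow> distinct xs \<longrightarrow>
      sum_list (map degs_below ts) = factor_degs (As @ Bs) + replicate_mset (2 * length xs) 1
      \<and> length ts = 2 * length ps"
proof (induction rule: rep_reps.inducts)
  case (rep_leaf x)
  then show ?case by (simp add: numeral_2_eq_2)
next
  case (rep_node B r Y \<beta> ts xs As ps Bs)
  show ?case
  proof
    assume dist: "distinct (r # Y @ xs)"
    with rep_node reps_sound have "decomp xs As ps Bs"
      by auto
    note pts = decomp_points[OF this]
    then have "distinct (r # ps)" "2 \<le> length (r # ps)"
      using dist reps_nonempty[OF rep_node.hyps(2,3)] by (auto simp: Suc_le_eq)
    with moved_cyc have "moved (cyc (r # ps)) = set (r # ps)" "distinct (r # ps)"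
      by blast+
    then have "card (moved (cyc (r # ps))) = Suc (length ps)"
      using distinct_card by fastforce
    moreover have "2 * length (r # Y @ xs) = 2 * length (r # Y) + 2 * length xs"
      by simp
    then have "replicate_mset (2 * length (r # Y @ xs)) (1::nat)
        = replicate_mset (2 * length (r # Y)) 1 + replicate_mset (2 * length xs) 1"
      by (simp only: replicate_mset_add)
    ultimately show "tree_degs (Node [Node (B # ts)])
        = factor_degs (As @ [cyc (r # ps)] @ Bs @ \<beta>) + replicate_mset (2 * length (r # Y @ xs)) 1"
      using rep_node.IH dist by (simp add: union_ac del: replicate_mset_Suc)
  qed
next
  case reps_Nil
  then show ?case by simp
next
  case (reps_Cons A a Z \<alpha> B Y \<beta> ts xs As ps Bs)
  show ?case
  proof
    assume dist: "distinct (Z @ a # Y @ xs)"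
    have A: "add_mset 1 (degs_below A) = factor_degs \<alpha> + replicate_mset (2 * length (a # Z)) 1"
      using reps_Cons.IH(1) dist by simp
    have B: "add_mset 1 (degs_below B) = factor_degs \<beta> + replicate_mset (2 * length (a # Y)) 1"
      using reps_Cons.IH(2) dist by simp
    have ts: "sum_list (map degs_below ts) = factor_degs (As @ Bs) + replicate_mset (2 * length xs) 1"
      "length ts = 2 * length ps"
      using reps_Cons.IH(3) dist by simp_all
    \<comment> \<open>The planting leaves of \<open>A\<close> and \<open>B\<close> disappear when
      both are attached to the top vertex, so one leaf is split off from each before
      cancelling.\<close>
    have two: "replicate_mset (2 * length (a # Z)) (1::nat) = add_mset 1 (replicate_mset (2 * length Z + 1) 1)"
        "replicate_mset (2 * length (a # Y)) (1::nat) = add_mset 1 (replicate_mset (2 * length Y + 1) 1)"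
      by simp_all
    have "degs_below A = factor_degs \<alpha> + replicate_mset (2 * length Z + 1) 1"
      "degs_below B = factor_degs \<beta> + replicate_mset (2 * length Y + 1) 1"
      using A B unfolding two by simp_all
    moreover have "2 * length (Z @ a # Y @ xs) = (2 * length Z + 1) + (2 * length Y + 1) + 2 * length xs"
      by simp
    then have "replicate_mset (2 * length (Z @ a # Y @ xs)) (1::nat) =
        replicate_mset (2 * length Z + 1) 1 + replicate_mset (2 * length Y + 1) 1
        + replicate_mset (2 * length xs) 1"
      by (simp only: replicate_mset_add)
    ultimately show "sum_list (map degs_below (A # B # ts))
        = factor_degs ((\<alpha> @ As) @ (Bs @ \<beta>)) + replicate_mset (2 * length (Z @ a # Y @ xs)) 1
        \<and> length (A # B # ts) = 2 * length (a # ps)"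
      using ts by (simp add: union_ac del: replicate_mset_Suc)
  qed
qed

section \<open>Trees and lists of points determine the factorization\<close>

lemma count_one_factor_degs: "count (factor_degs fs) 1 = 0"
  by (induction fs) auto

text \<open>Polygon vertices have even degree, so the multiplicity of degree 1 is the number of
  leaves, which is twice the number of points.\<close>

lemma rep_length_unique:
  assumes "rep T xs fs" "rep T ys gs" "distinct xs" "distinct ys"
  shows "length xs = length ys"
proof -
  have "factor_degs fs + replicate_mset (2 * length xs) 1
      = factor_degs gs + replicate_mset (2 * length ys) 1"
    using rep_degs[OF assms(1)] rep_degs[OF assms(2)] assms(3,4) by simp
  then show ?thesis
    by (metis (no_types, lifting) count_one_factor_degs add_0 count_replicate_mset count_union mult_cancel1 zero_neq_numeral)
qed

text \<open>Each subtree dictates the length of its part, so the list can be cut in one way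
  only.\<close>

lemma rep_functional: "rep T xs fs \<Longrightarrow> \<forall>gs. distinct xs \<longrightarrow> rep T xs gs \<longrightarrow> fs = gs"
  and reps_functional: "reps ts xs As ps Bs \<Longrightarrow> \<forall>As' ps' Bs'. distinct xs \<longrightarrow> reps ts xs As' ps' Bs'
      \<longrightarrow> As = As' \<and> ps = ps' \<and> Bs = Bs'"
proof (induction rule: rep_reps.inducts)
  case (rep_leaf x)
  then show ?case by (auto elim: rep.cases)
next
  case (rep_node B r Y \<beta> ts xs As ps Bs)
  show ?case
  proof (intro allI impI)
    fix gs assume dist: "distinct (r # Y @ xs)" and gs: "rep (Node (B # ts)) (r # Y @ xs) gs"
    from gs obtain Y' \<beta>' xs' As' ps' Bs' where *: "Y @ xs = Y' @ xs'"
      "gs = As' @ [cyc (r # ps')] @ Bs' @ \<beta>'" "rep B (r # Y') \<beta>'" "reps ts xs' As' ps' Bs'"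
      by (cases rule: rep.cases) auto
    have "distinct (Y' @ xs')"
      using dist *(1) by (metis distinct.simps(2))
    moreover have "r \<notin> set (Y' @ xs')"
      using dist *(1) by (metis distinct.simps(2))
    ultimately have "length (r # Y) = length (r # Y')"
      using rep_length_unique[OF rep_node.hyps(1) *(3)] dist by auto
    with *(1) have "Y = Y'" "xs = xs'"
      by auto
    with * dist rep_node.IH show "As @ [cyc (r # ps)] @ Bs @ \<beta> = gs"
      by auto
  qed
next
  case reps_Nil
  then show ?case by (auto elim: reps.cases)
next
  case (reps_Cons A a Z \<alpha> B Y \<beta> ts xs As ps Bs)
  show ?case
  proof (intro allI impI)
    fix As' ps' Bs'
    assume dist: "distinct (Z @ a # Y @ xs)" and reps': "reps (A # B # ts) (Z @ a # Y @ xs) As' ps' Bs'"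
    from reps' obtain Z' a' Y' xs' \<alpha>' \<beta>' As\<^sub>1 ps\<^sub>1 Bs\<^sub>1 where *: "Z @ a # Y @ xs = Z' @ a' # Y' @ xs'"
      "As' = \<alpha>' @ As\<^sub>1" "ps' = a' # ps\<^sub>1" "Bs' = Bs\<^sub>1 @ \<beta>'"
      "rep A (a' # Z') \<alpha>'" "rep B (a' # Y') \<beta>'" "reps ts xs' As\<^sub>1 ps\<^sub>1 Bs\<^sub>1"
      by (cases rule: reps.cases) auto
    have dist': "distinct (Z' @ a' # Y' @ xs')"
      using dist *(1) by metis
    have "length (a # Z) = length (a' # Z')"
      by (rule rep_length_unique[OF reps_Cons.hyps(1) *(5)]) (use dist dist' in auto)
    moreover have "length (a # Y) = length (a' # Y')"
      by (rule rep_length_unique[OF reps_Cons.hyps(2) *(6)]) (use dist dist' in auto)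
    ultimately have "Z = Z'" "a = a'" "Y = Y'" "xs = xs'"
      using *(1) by auto
    with * dist reps_Cons.IH show "\<alpha> @ As = As' \<and> a # ps = ps' \<and> Bs @ \<beta> = Bs'"
      by auto
  qed
qed

text \<open>The size \<open>m\<close> is chosen before the list: it depends on the subtrees alone,
  and the sizes must be known in order to cut \<open>xs\<close>. Evenness lets the children be taken
  in pairs.\<close>

lemma reps_exists:
  assumes "even (length ts)"
    and "\<And>t. t \<in> set ts \<Longrightarrow> \<exists>m. \<forall>xs. length xs = Suc m \<longrightarrow> (\<exists>fs. rep t xs fs)"
  shows "\<exists>m. \<forall>xs. length xs = m \<longrightarrow> (\<exists>As ps Bs. reps ts xs As ps Bs)"
  using assms
proof (induction ts rule: induct_list012)
  case 1
  then show ?case using reps_Nil by (intro exI[of _ 0]) auto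
next
  case (3 A B ts)
  obtain k where k: "\<forall>xs. length xs = Suc k \<longrightarrow> (\<exists>fs. rep A xs fs)"
    using "3.prems"(2)[of A] by auto
  obtain l where l: "\<forall>xs. length xs = Suc l \<longrightarrow> (\<exists>fs. rep B xs fs)"
    using "3.prems"(2)[of B] by auto
  obtain m where m: "\<forall>xs. length xs = m \<longrightarrow> (\<exists>As ps Bs. reps ts xs As ps Bs)"
    using "3.IH"(1) "3.prems" by auto
  show ?case
  proof (intro exI[of _ "k + Suc (l + m)"] allI impI)
    fix xs :: "nat list" assume len: "length xs = k + Suc (l + m)"
    define Z where "Z = take k xs"
    define a where "a = xs ! k"
    define Y where "Y = take l (drop (Suc k) xs)"
    define xs\<^sub>1 where "xs\<^sub>1 = drop l (drop (Suc k) xs)"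
    have "length Z = k" "length Y = l" "length xs\<^sub>1 = m"
      using len by (simp_all add: Z_def Y_def xs\<^sub>1_def)
    with k l m obtain \<alpha> \<beta> As ps Bs where
      "rep A (a # Z) \<alpha>" "rep B (a # Y) \<beta>" "reps ts xs\<^sub>1 As ps Bs"
      by (metis length_Cons)
    then have "reps (A # B # ts) (Z @ a # Y @ xs\<^sub>1) (\<alpha> @ As) (a # ps) (Bs @ \<beta>)"
      by (rule reps_Cons)
    moreover have "Z @ a # Y @ xs\<^sub>1 = xs"
      using len unfolding Z_def a_def Y_def xs\<^sub>1_def 
      by (simp only: append_take_drop_id) (simp add: id_take_nth_drop[symmetric])
    ultimately show "\<exists>As ps Bs. reps (A # B # ts) xs As ps Bs"
      by metis
  qed
qed simp

lemma rep_exists: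
  assumes "\<forall>d\<in>#degs_below T. d = 1 \<or> (\<exists>j\<ge>2. d = 2 * j)"
  shows "\<exists>m. \<forall>xs. length xs = Suc m \<longrightarrow> (\<exists>fs. rep T xs fs)"
  using assms
proof (induction T)
  case (Node ts)
  show ?case
  proof (cases ts)
    case Nil
    show ?thesis
    proof (intro exI[of _ 0] allI impI)
      fix xs :: "nat list" assume "length xs = Suc 0"
      then obtain x where "xs = [x]" by (auto simp: length_Suc_conv)
      with Nil rep_leaf show "\<exists>fs. rep (Node ts) xs fs" by blast
    qed
  next
    case (Cons B us)
    have ex: "\<exists>m. \<forall>xs. length xs = Suc m \<longrightarrow> (\<exists>fs. rep t xs fs)" if t: "t \<in> set ts" for t
    proof (rule Node.IH[OF t])
      show "\<forall>d\<in>#degs_below t. d = 1 \<or> (\<exists>j\<ge>2. d = 2 * j)"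
        using Node.prems t by simp
    qed
    \<comment> \<open>The children \<open>B # us\<close> and the parent edge give degree
      \<open>length us + 2\<close>. Hence \<open>us\<close> has even length, and
      \<open>2 \<le> j\<close> makes it nonempty.\<close>
    from Node.prems Cons obtain j where j: "2 \<le> j" "length us + 2 = 2 * j"
      by auto
    have "even (length us)"
      using j(2) by presburger
    moreover have "us \<noteq> []"
      using j by auto
    ultimately obtain m where m: "\<forall>xs. length xs = m \<longrightarrow> (\<exists>As ps Bs. reps us xs As ps Bs)"
      using reps_exists[of us] ex Cons by auto
    obtain k where k: "\<forall>xs. length xs = Suc k \<longrightarrow> (\<exists>fs. rep B xs fs)"
      using ex[of B] Cons by auto
    show ?thesis
    proof (intro exI[of _ "k + m"] allI impI)
      fix xs :: "nat list" assume len: "length xs = Suc (k + m)"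
      then obtain r xs' where xs: "xs = r # xs'" "length xs' = k + m"
        by (auto simp: length_Suc_conv)
      obtain \<beta> where "rep B (r # take k xs') \<beta>"
        using k xs(2) by (metis length_Cons length_take min_absorb2 le_add1)
      moreover obtain As ps Bs where "reps us (drop k xs') As ps Bs"
        using m xs(2) by (metis add_diff_cancel_left' length_drop)
      ultimately have "rep (Node (B # us)) (r # take k xs' @ drop k xs') (As @ [cyc (r # ps)] @ Bs @ \<beta>)"
        using \<open>us \<noteq> []\<close> by (rule rep_node)
      with xs Cons show "\<exists>fs. rep (Node ts) xs fs"
        by auto
    qed
  qed
qed

section \<open>The tree is determined by the set of factors\<close>

text \<open>Such an \<open>S\<close> is closed under every factor, hence under their product, a
  cycle through \<open>a\<close>. Applied to two competing splittings, this shows that their parts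
  contain each other.\<close>

lemma min_fact_inside:
  assumes "min_fact (a # Y) \<beta>" "a \<in> S" "\<And>f. f \<in> set \<beta> \<Longrightarrow> moved f \<subseteq> S \<or> moved f \<inter> S = {}"
  shows "set Y \<subseteq> S"
proof -
  have step: "f y \<in> S" if f: "f \<in> set \<beta>" and y: "y \<in> S" for f y
  proof (cases "f y = y")
    case False
    have "inj f"
      using assms(1) f cycle_on_permutes permutes_inj unfolding min_fact_def by blast
    with False have "f (f y) \<noteq> f y"
      by (simp add: inj_eq)
    with False y assms(3)[OF f] show ?thesis
      by (auto simp: moved_def)
  qed (use y in simp)
  have "list_prod gs y \<in> S" if "set gs \<subseteq> set \<beta>" "y \<in> S" for gs y
    using that by (induction gs) (auto intro: step)
  then have "cyc (a # Y) y \<in> S" if "y \<in> S" for y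
    using that assms(1) unfolding min_fact_def by (metis order_refl)
  then have "set (a # Y) \<subseteq> S"
    using assms(1,2) unfolding min_fact_def by (intro cyc_transitive[of _ a]) auto
  then show ?thesis by simp
qed

lemma append_eq_append_disjoint:
  assumes "Y @ xs = Y' @ xs'" "set Y \<inter> set xs' = {}" "set Y' \<inter> set xs = {}"
  shows "Y = Y' \<and> xs = xs'"
proof -
  from assms(1) obtain us where "Y = Y' @ us \<and> us @ xs = xs' \<or> Y @ us = Y' \<and> xs = us @ xs'"
    by (auto simp: append_eq_append_conv2)
  with assms(2,3) show ?thesis
    by (cases us) auto
qed

lemma min_fact_moved:
  assumes "min_fact xs fs" "f \<in> set fs"
  shows "moved f \<subseteq> set xs" "2 \<le> card (moved f)"
  using assms cycle_on_moved unfolding min_fact_def by blast+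

lemma decomp_moved:
  assumes "decomp xs As ps Bs" "f \<in> set As \<union> set Bs"
  shows "moved f \<subseteq> set xs" "2 \<le> card (moved f)"
  using cycle_on_moved[OF decomp_cycle_on[OF assms]] by blast+

lemma not_two_le_card_subset_singleton: "2 \<le> card S \<Longrightarrow> \<not> S \<subseteq> {a}"
  using card_mono[of "{a}" S] by auto

text \<open>The root cycle meets both \<open>r # Y\<close> and \<open>xs\<close>, while every other
  factor stays on one side. The parts can thus be read off from \<open>F\<close> and the two lists,
  without the order of the factors.\<close>

lemma root_parts:
  assumes "decomp xs As ps Bs" "xs \<noteq> []" "min_fact (r # Y) \<beta>" "distinct (r # Y @ xs)"
    and "F = set (As @ [cyc (r # ps)] @ Bs @ \<beta>)"
  shows "set \<beta> = {f \<in> F. moved f \<subseteq> set (r # Y)}"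
    and "set As \<union> set Bs = {f \<in> F. moved f \<subseteq> set xs}"
    and "moved (cyc (r # ps)) = set (r # ps)"
    and "\<And>f. f \<in> F \<Longrightarrow> r \<in> moved f \<Longrightarrow> f \<noteq> cyc (r # ps) \<Longrightarrow> moved f \<subseteq> set (r # Y)"
proof -
  have pts: "set ps \<subseteq> set xs" "distinct ps" "ps \<noteq> []"
    using decomp_points[OF assms(1)] assms(2) by auto
  have "distinct (r # ps)" "2 \<le> length (r # ps)"
    using pts assms(4) by (auto simp: Suc_le_eq)
  then show p: "moved (cyc (r # ps)) = set (r # ps)"
    by (rule moved_cyc)
  obtain x where x: "x \<in> set ps" "x \<in> set xs"
    using pts by (metis list.set_sel(1) subsetD)
  have AB: "moved f \<subseteq> set xs" "\<not> moved f \<subseteq> set (r # Y)" if "f \<in> set As \<union> set Bs" for f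
    using decomp_moved[OF assms(1) that] not_two_le_card_subset_singleton[of "moved f" r] assms(4) by auto
  have \<beta>: "moved f \<subseteq> set (r # Y)" "\<not> moved f \<subseteq> set xs" if "f \<in> set \<beta>" for f
    using min_fact_moved[OF assms(3) that] not_two_le_card_subset_singleton[of "moved f" r] assms(4) by auto
  have p': "\<not> moved (cyc (r # ps)) \<subseteq> set (r # Y)" "\<not> moved (cyc (r # ps)) \<subseteq> set xs"
    using p x assms(4) by auto
  show "set \<beta> = {f \<in> F. moved f \<subseteq> set (r # Y)}" "set As \<union> set Bs = {f \<in> F. moved f \<subseteq> set xs}"
    using AB \<beta> p' assms(5) by auto
  show "moved f \<subseteq> set (r # Y)" if "f \<in> F" "r \<in> moved f" "f \<noteq> cyc (r # ps)" for f
    using that AB \<beta> assms(4,5) by auto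
qed

text \<open>The point sets of the parts meet at most in \<open>a\<close>, and a factor moves two
  points, so it fits into only one of them. \<open>As\<close> and \<open>Bs\<close> live on the same
  points, so only their union is recovered at this stage.\<close>

lemma block_parts:
  assumes "min_fact (a # Z) \<alpha>" "min_fact (a # Y) \<beta>" "decomp xs As ps Bs" "distinct (Z @ a # Y @ xs)"
    and "F = set (\<alpha> @ As) \<union> set (Bs @ \<beta>)"
  shows "set \<alpha> = {f \<in> F. moved f \<subseteq> set (a # Z)}"
    and "set \<beta> = {f \<in> F. moved f \<subseteq> set (a # Y)}"
    and "set As \<union> set Bs = {f \<in> F. moved f \<subseteq> set xs}"
    and "\<And>f. f \<in> F \<Longrightarrow> moved f \<subseteq> set (Z @ a # Y) \<or> moved f \<inter> set (Z @ a # Y) = {}"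
proof -
  have disj: "set (a # Z) \<inter> set (a # Y) \<subseteq> {a}" "set (a # Z) \<inter> set xs \<subseteq> {a}" "set (a # Y) \<inter> set xs \<subseteq> {a}"
    using assms(4) by auto
  have sep: "\<not> moved f \<subseteq> W" if "2 \<le> card (moved f)" "moved f \<subseteq> V" "V \<inter> W \<subseteq> {a}" for f :: "nat \<Rightarrow> nat" and V W
    using not_two_le_card_subset_singleton[OF that(1), of a] that(2,3) by blast
  have \<alpha>: "moved f \<subseteq> set (a # Z)" "\<not> moved f \<subseteq> set (a # Y)" "\<not> moved f \<subseteq> set xs" if "f \<in> set \<alpha>" for f
    using min_fact_moved[OF assms(1) that] sep disj by blast+
  have \<beta>: "moved f \<subseteq> set (a # Y)" "\<not> moved f \<subseteq> set (a # Z)" "\<not> moved f \<subseteq> set xs" if "f \<in> set \<beta>" for f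
    using min_fact_moved[OF assms(2) that] sep disj by (metis Int_commute)+
  have AB: "moved f \<subseteq> set xs" "\<not> moved f \<subseteq> set (a # Z)" "\<not> moved f \<subseteq> set (a # Y)"
    if "f \<in> set As \<union> set Bs" for f
    using decomp_moved[OF assms(3) that] sep disj by (metis Int_commute)+
  have F: "f \<in> F \<longleftrightarrow> f \<in> set \<alpha> \<or> f \<in> set \<beta> \<or> f \<in> set As \<union> set Bs" for f
    using assms(5) by auto
  show "set \<alpha> = {f \<in> F. moved f \<subseteq> set (a # Z)}"
    using \<alpha>(1) \<beta>(2) AB(2) F by blast
  show "set \<beta> = {f \<in> F. moved f \<subseteq> set (a # Y)}"
    using \<alpha>(2) \<beta>(1) AB(3) F by blast
  show "set As \<union> set Bs = {f \<in> F. moved f \<subseteq> set xs}"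
    using \<alpha>(3) \<beta>(3) AB(1) F by blast
  show "moved f \<subseteq> set (Z @ a # Y) \<or> moved f \<inter> set (Z @ a # Y) = {}" if "f \<in> F" for f
  proof -
    from that assms(5) consider "f \<in> set \<alpha>" | "f \<in> set \<beta>" | "f \<in> set As \<union> set Bs"
      by auto
    then show ?thesis
    proof cases
      case 1
      with \<alpha>(1)[of f] show ?thesis by auto
    next
      case 2
      with \<beta>(1)[of f] show ?thesis by auto
    next
      case 3
      with AB(1)[of f] assms(4) show ?thesis by auto
    qed
  qed
qed

text \<open>Which factor at \<open>r\<close> is applied last is forced by the linear order of the
  points, so that the bare set of factors suffices.\<close>

lemma root_unique:
  assumes "decomp xs As ps Bs" "xs \<noteq> []" "min_fact (r # Y) \<beta>" "distinct (r # Y @ xs)"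
    and "decomp xs' As' ps' Bs'" "xs' \<noteq> []" "min_fact (r # Y') \<beta>'" "Y @ xs = Y' @ xs'"
    and "set (As @ [cyc (r # ps)] @ Bs @ \<beta>) = set (As' @ [cyc (r # ps')] @ Bs' @ \<beta>')"
  shows "Y = Y'" "xs = xs'" "ps = ps'" "set \<beta> = set \<beta>'" "set As \<union> set Bs = set As' \<union> set Bs'"
proof -
  define F where "F = set (As @ [cyc (r # ps)] @ Bs @ \<beta>)"
  have F': "F = set (As' @ [cyc (r # ps')] @ Bs' @ \<beta>')"
    using assms(9) by (simp only: F_def)
  have dist': "distinct (r # Y' @ xs')"
    using assms(4,8) by simp
  note parts = root_parts[OF assms(1-4) F_def] and parts' = root_parts[OF assms(5-7) dist' F']
  note pts = decomp_points[OF assms(1)] and pts' = decomp_points[OF assms(5)]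
  have p_eq: "cyc (r # ps) = cyc (r # ps')"
  proof (rule ccontr)
    assume neq: "cyc (r # ps) \<noteq> cyc (r # ps')"
    have "cyc (r # ps) \<in> F" "cyc (r # ps') \<in> F"
      by (simp add: F_def) (simp add: F')
    with neq parts(3) parts'(3) parts(4)[of "cyc (r # ps')"] parts'(4)[of "cyc (r # ps)"]
    have sub: "set ps \<subseteq> insert r (set Y')" "set ps' \<subseteq> insert r (set Y)"
      by auto
    \<comment> \<open>Each root cycle has a point beyond its own \<open>Y\<close> that lies in the
      \<open>Y\<close> of the other splitting. Both are prefixes of one list, so one contains the
      other; either inclusion is contradictory.\<close>
    obtain x x' where x: "x \<in> set ps" "x \<in> set xs" "x' \<in> set ps'" "x' \<in> set xs'"
      using pts pts' assms(2,6) by (metis list.set_sel(1) subsetD)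
    moreover have "r \<notin> set xs" "r \<notin> set xs'"
      using assms(4) dist' by simp_all
    ultimately have "x \<in> set Y'" "x' \<in> set Y"
      using sub by blast+
    moreover have "set Y \<subseteq> set Y' \<or> set Y' \<subseteq> set Y"
      using assms(8) unfolding append_eq_append_conv2 by (metis set_append sup_ge1)
    moreover have "set Y \<inter> set xs = {}" "set Y' \<inter> set xs' = {}"
      using assms(4) dist' by simp_all
    ultimately show False
      using x by blast
  qed
  have dps: "distinct (r # ps)" "distinct (r # ps')"
    using pts pts' assms(4) dist' by auto
  show "ps = ps'"
    by (rule cyc_inject[OF dps p_eq])
  \<comment> \<open>Without the root cycle, \<open>r # Y\<close> is a union of components, so the
    factors of \<beta>' cannot lead out of it.\<close>
  have "set Y' \<subseteq> set (r # Y)"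
  proof (rule min_fact_inside[OF assms(7)])
    fix f assume f: "f \<in> set \<beta>'"
    then have fF: "f \<in> F" and mf: "moved f \<subseteq> set (r # Y')"
      using parts'(1) by auto
    have "f \<noteq> cyc (r # ps)"
    proof
      assume "f = cyc (r # ps)"
      with mf p_eq parts'(3) have "set ps' \<subseteq> set Y'"
        using dps(2) by auto
      moreover have "ps' \<noteq> []" "set ps' \<subseteq> set xs'"
        using pts' assms(6) by auto
      ultimately show False
        using dist' by (metis disjoint_iff distinct.simps(2) distinct_append list.set_sel(1) subsetD)
    qed
    with fF consider "f \<in> set \<beta>" | "f \<in> set As \<union> set Bs"
      unfolding F_def by auto
    then show "moved f \<subseteq> set (r # Y) \<or> moved f \<inter> set (r # Y) = {}"
    proof cases
      case 1
      then show ?thesis using parts(1) by auto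
    next
      case 2
      then have "moved f \<subseteq> set xs" using parts(2) by auto
      then show ?thesis using assms(4) by auto
    qed
  qed simp
  moreover have "set Y \<subseteq> set (r # Y')"
  proof (rule min_fact_inside[OF assms(3)])
    fix f assume f: "f \<in> set \<beta>"
    then have fF: "f \<in> F" and mf: "moved f \<subseteq> set (r # Y)"
      using parts(1) by auto
    have "f \<noteq> cyc (r # ps')"
    proof
      assume "f = cyc (r # ps')"
      with mf p_eq parts(3) have "set ps \<subseteq> set Y"
        using dps(1) by auto
      moreover have "ps \<noteq> []" "set ps \<subseteq> set xs"
        using pts assms(2) by auto
      ultimately show False
        using assms(4) by (metis disjoint_iff distinct.simps(2) distinct_append list.set_sel(1) subsetD)
    qed
    with fF consider "f \<in> set \<beta>'" | "f \<in> set As' \<union> set Bs'"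
      unfolding F' by auto
    then show "moved f \<subseteq> set (r # Y') \<or> moved f \<inter> set (r # Y') = {}"
    proof cases
      case 1
      then show ?thesis using parts'(1) by auto
    next
      case 2
      then have "moved f \<subseteq> set xs'" using parts'(2) by auto
      then show ?thesis using dist' by auto
    qed
  qed simp
  ultimately have "set Y' \<inter> set xs = {}" "set Y \<inter> set xs' = {}"
    using assms(4) dist' by auto
  with append_eq_append_disjoint[OF assms(8)] show "Y = Y'" "xs = xs'"
    by auto
  with parts(1,2) parts'(1,2) show "set \<beta> = set \<beta>'" "set As \<union> set Bs = set As' \<union> set Bs'"
    by simp_all
qed

text \<open>As the polygon point \<open>a\<close> is known, it fixes \<open>Z\<close> by its
  position. The cut after \<open>Y\<close> is found from the whole block \<open>Z @ a # Y\<close>,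
  since \<open>a # Y\<close> alone may meet factors of \<alpha> in \<open>a\<close>.\<close>

lemma block_unique:
  assumes "min_fact (a # Z) \<alpha>" "min_fact (a # Y) \<beta>" "decomp xs As ps Bs" "distinct (Z @ a # Y @ xs)"
    and "min_fact (a # Z') \<alpha>'" "min_fact (a # Y') \<beta>'" "decomp xs' As' ps' Bs'"
    and "Z @ a # Y @ xs = Z' @ a # Y' @ xs'"
    and "set (\<alpha> @ As) \<union> set (Bs @ \<beta>) = set (\<alpha>' @ As') \<union> set (Bs' @ \<beta>')"
  shows "Z = Z'" "Y = Y'" "xs = xs'" "set \<alpha> = set \<alpha>'" "set \<beta> = set \<beta>'"
    "set As \<union> set Bs = set As' \<union> set Bs'"
proof -
  define F where "F = set (\<alpha> @ As) \<union> set (Bs @ \<beta>)"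
  have F': "F = set (\<alpha>' @ As') \<union> set (Bs' @ \<beta>')"
    using assms(9) by (simp only: F_def)
  have dist': "distinct (Z' @ a # Y' @ xs')"
    using assms(4,8) by metis
  note parts = block_parts[OF assms(1-4) F_def] and parts' = block_parts[OF assms(5-7) dist' F']
  have "a \<notin> set Z" "a \<notin> set (Y @ xs)"
    using assms(4) by auto
  with append_Cons_eq_iff assms(8) have ZY: "Z = Z'" "Y @ xs = Y' @ xs'"
    by metis+
  have "set Y' \<subseteq> set (Z @ a # Y)"
  proof (rule min_fact_inside[OF assms(6)])
    show "moved f \<subseteq> set (Z @ a # Y) \<or> moved f \<inter> set (Z @ a # Y) = {}" if "f \<in> set \<beta>'" for f
      using that parts'(2) by (intro parts(4)) auto
  qed simp
  moreover have "set Y \<subseteq> set (Z' @ a # Y')"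
  proof (rule min_fact_inside[OF assms(2)])
    show "moved f \<subseteq> set (Z' @ a # Y') \<or> moved f \<inter> set (Z' @ a # Y') = {}" if "f \<in> set \<beta>" for f
      using that parts(2) by (intro parts'(4)) auto
  qed simp
  ultimately have "set Y' \<inter> set xs = {}" "set Y \<inter> set xs' = {}"
    using assms(4) dist' by auto
  with append_eq_append_disjoint[OF ZY(2)] show "Y = Y'" "xs = xs'"
    by auto
  with ZY parts(1-3) parts'(1-3) show "Z = Z'" "set \<alpha> = set \<alpha>'" "set \<beta> = set \<beta>'"
    "set As \<union> set Bs = set As' \<union> set Bs'"
    by simp_all
qed

text \<open>In the second statement \<open>ps\<close> is shared, because the root cycle is
  identified before descending; it then tells where the blocks lie.\<close>

lemma rep_inject: "rep T xs fs \<Longrightarrow> \<forall>T' fs'. distinct xs \<longrightarrow> rep T' xs fs' \<longrightarrow> set fs = set fs' \<longrightarrow> T = T'"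
  and reps_inject: "reps ts xs As ps Bs \<Longrightarrow> \<forall>ts' As' Bs'. distinct xs \<longrightarrow> reps ts' xs As' ps Bs'
      \<longrightarrow> set As \<union> set Bs = set As' \<union> set Bs' \<longrightarrow> ts = ts'"
proof (induction rule: rep_reps.inducts)
  case (rep_leaf x)
  then show ?case
    by (auto elim!: rep.cases dest!: reps_nonempty)
next
  case (rep_node B r Y \<beta> ts xs As ps Bs)
  show ?case
  proof (intro allI impI)
    fix T' fs'
    assume dist: "distinct (r # Y @ xs)" and T': "rep T' (r # Y @ xs) fs'"
      and sets: "set (As @ [cyc (r # ps)] @ Bs @ \<beta>) = set fs'"
    have "xs \<noteq> []"
      using reps_nonempty rep_node.hyps(2,3) by blast
    with T' obtain B' ts' Y' xs' As' ps' Bs' \<beta>' where *: "T' = Node (B' # ts')" "Y @ xs = Y' @ xs'"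
      "fs' = As' @ [cyc (r # ps')] @ Bs' @ \<beta>'" "rep B' (r # Y') \<beta>'" "reps ts' xs' As' ps' Bs'" "ts' \<noteq> []"
      by (cases rule: rep.cases) auto
    have dist': "distinct (r # Y' @ xs')"
      using dist *(2) by simp
    have xs': "xs' \<noteq> []"
      using reps_nonempty *(5,6) by blast
    have "decomp xs As ps Bs" "min_fact (r # Y) \<beta>" "decomp xs' As' ps' Bs'" "min_fact (r # Y') \<beta>'"
      using reps_sound[OF rep_node.hyps(2)] rep_sound[OF rep_node.hyps(1)] reps_sound[OF *(5)]
        rep_sound[OF *(4)] dist dist' by auto
    note uniq = root_unique[OF this(1) \<open>xs \<noteq> []\<close> this(2) dist this(3) xs' this(4) *(2) sets[unfolded *(3)]]
    have "B = B'"
      using rep_node.IH(1) *(4) uniq(1,4) dist by auto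
    moreover have "ts = ts'"
      using rep_node.IH(2) *(5) uniq(2,3,5) dist by auto
    ultimately show "Node (B # ts) = T'"
      using *(1) by simp
  qed
next
  case reps_Nil
  then show ?case by (auto elim: reps.cases)
next
  case (reps_Cons A a Z \<alpha> B Y \<beta> ts xs As ps Bs)
  show ?case
  proof (intro allI impI)
    fix ts' As' Bs'
    assume dist: "distinct (Z @ a # Y @ xs)" and reps': "reps ts' (Z @ a # Y @ xs) As' (a # ps) Bs'"
      and sets: "set (\<alpha> @ As) \<union> set (Bs @ \<beta>) = set As' \<union> set Bs'"
    from reps' obtain A' B' ts\<^sub>1 Z' Y' xs' \<alpha>' \<beta>' As\<^sub>1 Bs\<^sub>1 where *:
      "ts' = A' # B' # ts\<^sub>1" "Z @ a # Y @ xs = Z' @ a # Y' @ xs'" "As' = \<alpha>' @ As\<^sub>1" "Bs' = Bs\<^sub>1 @ \<beta>'"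
      "rep A' (a # Z') \<alpha>'" "rep B' (a # Y') \<beta>'" "reps ts\<^sub>1 xs' As\<^sub>1 ps Bs\<^sub>1"
      by (rule reps_Cons_points)
    have dist': "distinct (Z' @ a # Y' @ xs')"
      using dist *(2) by metis
    have "min_fact (a # Z) \<alpha>" "min_fact (a # Y) \<beta>" "decomp xs As ps Bs"
      using rep_sound[OF reps_Cons.hyps(1)] rep_sound[OF reps_Cons.hyps(2)]
        reps_sound[OF reps_Cons.hyps(3)] dist by auto
    moreover have "min_fact (a # Z') \<alpha>'" "min_fact (a # Y') \<beta>'" "decomp xs' As\<^sub>1 ps Bs\<^sub>1"
      using rep_sound[OF *(5)] rep_sound[OF *(6)] reps_sound[OF *(7)] dist' by auto
    ultimately have uniq: "Z = Z'" "Y = Y'" "xs = xs'" "set \<alpha> = set \<alpha>'" "set \<beta> = set \<beta>'"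
      "set As \<union> set Bs = set As\<^sub>1 \<union> set Bs\<^sub>1"
      using block_unique[OF _ _ _ dist _ _ _ *(2) sets[unfolded *(3,4)]] by blast+
    have "A = A'"
      using reps_Cons.IH(1) *(5) uniq(1,4) dist by auto
    moreover have "B = B'"
      using reps_Cons.IH(2) *(6) uniq(2,5) dist by auto
    moreover have "ts = ts\<^sub>1"
      using reps_Cons.IH(3) *(7) uniq(3,6) dist by auto
    ultimately show "A # B # ts = ts'"
      using *(1) by simp
  qed
qed

section \<open>Peeling off the leftmost factor\<close>

text \<open>
  The fibres of \<^term>\<open>\<kappa>\<close> are unions of connected components of the hypergraph whose edges are the
  supports of the factors; adding an edge with \<open>k\<close> points merges at most \<open>k\<close> components.
\<close>

lemma component_function:
  assumes "\<And>f. f \<in> set fs \<Longrightarrow> cycle_on V f" "finite V"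
  obtains \<kappa> :: "'a \<Rightarrow> 'a" where "\<And>f x. f \<in> set fs \<Longrightarrow> \<kappa> (f x) = \<kappa> x" "card V \<le> card (\<kappa> ` V) + weight fs"
proof -
  have "\<exists>\<kappa> :: 'a \<Rightarrow> 'a. (\<forall>f\<in>set fs. \<forall>x. \<kappa> (f x) = \<kappa> x) \<and> card V \<le> card (\<kappa> ` V) + weight fs"
    using assms(1)
  proof (induction fs)
    case Nil
    show ?case by (intro exI[of _ id]) simp
  next
    case (Cons f fs)
    obtain \<kappa> :: "'a \<Rightarrow> 'a" where \<kappa>: "\<forall>g\<in>set fs. \<forall>x. \<kappa> (g x) = \<kappa> x" "card V \<le> card (\<kappa> ` V) + weight fs"
      using Cons.IH Cons.prems by (metis list.set_intros(2))
    have f: "cycle_on V f"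
      using Cons.prems by simp
    note mv = cycle_on_moved[OF f]
    obtain x\<^sub>0 where x\<^sub>0: "x\<^sub>0 \<in> moved f"
      using mv(3) by fastforce
    define \<kappa>' where "\<kappa>' x = (if \<kappa> x \<in> \<kappa> ` moved f then \<kappa> x\<^sub>0 else \<kappa> x)" for x
    have "\<kappa>' (f x) = \<kappa>' x" for x
    proof (cases "f x = x")
      case False
      have "inj f"
        using cycle_on_permutes[OF f] permutes_inj by blast
      with False have "x \<in> moved f" "f x \<in> moved f"
        by (simp_all add: moved_def inj_eq)
      then show ?thesis by (simp add: \<kappa>'_def)
    qed simp
    moreover have "\<kappa>' (g x) = \<kappa>' x" if "g \<in> set fs" for g x
      using \<kappa>(1) that by (simp add: \<kappa>'_def)
    moreover have "card V \<le> card (\<kappa>' ` V) + weight (f # fs)"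
    proof -
      \<comment> \<open>A merged-away value belongs to \<open>moved f\<close> and differs from the
        representative \<open>\<kappa> x\<^sub>0\<close>, so at most
        \<open>card (moved f) - 1\<close> values are lost.\<close>
      have "\<kappa> v \<in> \<kappa>' ` V \<union> (\<kappa> ` moved f - {\<kappa> x\<^sub>0})" if "v \<in> V" for v
      proof (cases "\<kappa> v \<in> \<kappa> ` moved f \<and> \<kappa> v \<noteq> \<kappa> x\<^sub>0")
        case False
        then have "\<kappa>' v = \<kappa> v"
          by (auto simp: \<kappa>'_def)
        with that show ?thesis by (metis UnI1 imageI)
      qed simp
      then have "card (\<kappa> ` V) \<le> card (\<kappa>' ` V \<union> (\<kappa> ` moved f - {\<kappa> x\<^sub>0}))"
        using assms(2) mv(2) by (intro card_mono) auto
      also have "\<dots> \<le> card (\<kappa>' ` V) + card (\<kappa> ` moved f - {\<kappa> x\<^sub>0})"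
        by (rule card_Un_le)
      also have "card (\<kappa> ` moved f - {\<kappa> x\<^sub>0}) = card (\<kappa> ` moved f) - 1"
        using x\<^sub>0 by (simp add: card_Diff_singleton)
      also have "card (\<kappa> ` moved f) - 1 \<le> card (moved f) - 1"
        using card_image_le[OF mv(2), of \<kappa>] by simp
      finally show ?thesis using \<kappa>(2) by simp
    qed
    ultimately show ?case by (intro exI[of _ \<kappa>']) simp
  qed
  then show thesis using that by blast
qed

lemma list_prod_invariant:
  assumes "\<And>f x. f \<in> set fs \<Longrightarrow> \<kappa> (f x) = \<kappa> x"
  shows "\<kappa> (list_prod fs x) = \<kappa> x"
  using assms by (induction fs) simp_all

text \<open>The general lower bound on the weight: the product is transitive, so only one component
  is left.\<close>

lemma length_le_weight:
  assumes "distinct (r # w)" "\<And>f. f \<in> set fs \<Longrightarrow> cycle_on (set (r # w)) f" "list_prod fs = cyc (r # w)"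
  shows "length (r # w) \<le> Suc (weight fs)"
proof -
  obtain \<kappa> :: "nat \<Rightarrow> nat" where \<kappa>: "\<And>f x. f \<in> set fs \<Longrightarrow> \<kappa> (f x) = \<kappa> x"
    "card (set (r # w)) \<le> card (\<kappa> ` set (r # w)) + weight fs"
    using component_function[of fs "set (r # w)"] assms(2) by blast
  have "\<kappa> (cyc (r # w) y) = \<kappa> y" for y
    using list_prod_invariant[of fs \<kappa> y] \<kappa>(1) assms(3) by simp
  then have "set (r # w) \<subseteq> {y. \<kappa> y = \<kappa> r}"
    by (intro cyc_transitive[of _ r]) (use assms(1) in auto)
  then have "\<kappa> ` set (r # w) \<subseteq> {\<kappa> r}"
    by blast
  then have "card (\<kappa> ` set (r # w)) \<le> 1"
    using card_mono[of "{\<kappa> r}"] by simp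
  with \<kappa>(2) assms(1) show ?thesis
    using distinct_card[OF assms(1)] by linarith
qed

section \<open>Restricting a product to unions of components\<close>

lemma list_prod_permutes: "(\<And>f. f \<in> set fs \<Longrightarrow> f permutes K) \<Longrightarrow> list_prod fs permutes K"
proof (induction fs)
  case Nil
  show ?case unfolding list_prod_Nil by (rule permutes_id)
next
  case (Cons f fs)
  have "list_prod fs permutes K"
    by (rule Cons.IH, rule Cons.prems) simp
  then show ?case
    unfolding list_prod_Cons by (rule permutes_compose) (rule Cons.prems, simp)
qed

lemma list_prod_filter:
  assumes "\<And>f. f \<in> set fs \<Longrightarrow> cycle_on V f" "\<And>f. f \<in> set fs \<Longrightarrow> moved f \<subseteq> K \<or> moved f \<inter> K = {}" "x \<in> K"
  shows "list_prod fs x = list_prod (filter (\<lambda>f. moved f \<subseteq> K) fs) x \<and> list_prod fs x \<in> K"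
  using assms(1,2)
proof (induction fs)
  case (Cons f fs)
  define y where "y = list_prod fs x"
  have IH: "y = list_prod (filter (\<lambda>f. moved f \<subseteq> K) fs) x" "y \<in> K"
    using Cons unfolding y_def by auto
  show ?case
  proof (cases "moved f \<subseteq> K")
    case True
    have "f permutes K"
      using Cons.prems(1) True by (intro cycle_on_permutes cycle_on_subset[of V f K]) auto
    with IH True show ?thesis
      by (simp add: y_def permutes_in_image)
  next
    case False
    with Cons.prems(2)[of f] IH(2) have "f y = y"
      by (auto simp: moved_def)
    with IH False show ?thesis by (simp add: y_def)
  qed
qed (use assms(3) in simp)

lemma weight_partition:
  assumes "finite C" "\<And>f. f \<in> set fs \<Longrightarrow> \<exists>!c. c \<in> C \<and> P c f"
  shows "weight fs = (\<Sum>c\<in>C. weight (filter (P c) fs))"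
  using assms(2)
proof (induction fs)
  case (Cons f fs)
  obtain c\<^sub>0 where c\<^sub>0: "c\<^sub>0 \<in> C" "\<And>c. c \<in> C \<Longrightarrow> P c f \<longleftrightarrow> c = c\<^sub>0"
    using Cons.prems[of f] by auto
  have "(\<Sum>c\<in>C. weight (filter (P c) (f # fs)))
      = (\<Sum>c\<in>C. (if c = c\<^sub>0 then card (moved f) - 1 else 0) + weight (filter (P c) fs))"
    by (rule sum.cong) (use c\<^sub>0 in auto)
  also have "\<dots> = (card (moved f) - 1) + weight fs"
    using assms(1) c\<^sub>0(1) Cons.IH Cons.prems by (simp add: sum.distrib)
  finally show ?case by simp
qed simp

text \<open>Factors in different pieces have disjoint supports, so the word can be sorted by piece.
  All "after" parts are empty, as required for the last applied factor.\<close>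

lemma decomp_assemble:
  assumes "distinct ps" "\<And>c. c \<in> set ps \<Longrightarrow> min_fact (c # Y c) (filter (\<lambda>f. moved f \<subseteq> set (c # Y c)) fs)"
    and "\<And>c d. c \<in> set ps \<Longrightarrow> d \<in> set ps \<Longrightarrow> c \<noteq> d \<Longrightarrow> set (c # Y c) \<inter> set (d # Y d) = {}"
    and "\<And>f. f \<in> set fs \<Longrightarrow> cycle_on V f \<and> (\<exists>c\<in>set ps. moved f \<subseteq> set (c # Y c))"
  shows "\<exists>Bs. decomp (concat (map (\<lambda>c. c # Y c) ps)) [] ps Bs \<and> fs \<sim> Bs"
  using assms
proof (induction ps arbitrary: fs)
  case Nil
  then have "fs = []"
    by (cases fs) auto
  then show ?case
    using decomp_Nil by (intro exI[of _ "[]"]) simp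
next
  case (Cons c ps)
  let ?P = "\<lambda>c f. moved f \<subseteq> set (c # Y c)"
  define fs\<^sub>1 where "fs\<^sub>1 = filter (\<lambda>f. \<not> ?P c f) fs"
  have ne: "moved f \<noteq> {}" if "f \<in> set fs" for f
    using Cons.prems(4)[OF that] cycle_on_moved(3)[of V f] by auto
  have disj: "set (c # Y c) \<inter> set (d # Y d) = {}" if d: "d \<in> set ps" for d
  proof (rule Cons.prems(3))
    show "c \<noteq> d" using Cons.prems(1) d by auto
  qed (use d in simp_all)
  have excl: "\<not> ?P c f" if "f \<in> set fs" "d \<in> set ps" "?P d f" for f d
  proof -
    from disj[OF that(2)] that(3) ne[OF that(1)] show ?thesis by blast
  qed
  have "filter (?P d) fs\<^sub>1 = filter (?P d) fs" if "d \<in> set ps" for d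
    using excl[OF _ that] unfolding fs\<^sub>1_def filter_filter by (intro filter_cong) auto
  then have "\<exists>Bs. decomp (concat (map (\<lambda>c. c # Y c) ps)) [] ps Bs \<and> fs\<^sub>1 \<sim> Bs"
  proof (intro Cons.IH)
    show "cycle_on V f \<and> (\<exists>c\<in>set ps. ?P c f)" if "f \<in> set fs\<^sub>1" for f
      using that Cons.prems(4)[of f] unfolding fs\<^sub>1_def by auto
  qed (use Cons.prems in auto)
  then obtain Bs where Bs: "decomp (concat (map (\<lambda>c. c # Y c) ps)) [] ps Bs" "fs\<^sub>1 \<sim> Bs"
    by blast
  have "f \<circ> g = g \<circ> f" if fg: "f \<in> set fs" "g \<in> set fs" "?P c f" "\<not> ?P c g" for f g
  proof -
    obtain d where d: "d \<in> set ps" "?P d g"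
      using Cons.prems(4)[OF fg(2)] fg(4) by auto
    from disj[OF d(1)] d(2) fg(3) have "moved f \<inter> moved g = {}"
      by blast
    then show ?thesis
      using cycle_on_commute Cons.prems(4) fg(1,2) by blast
  qed
  then have "fs \<sim> fs\<^sub>1 @ filter (?P c) fs"
    unfolding fs\<^sub>1_def by (rule fact_equiv_filter)
  also have "fs\<^sub>1 @ filter (?P c) fs \<sim> Bs @ filter (?P c) fs"
    using Bs(2) by (intro fact_equiv_append) simp_all
  finally have "fs \<sim> Bs @ filter (?P c) fs" .
  moreover have "decomp ([] @ c # Y c @ concat (map (\<lambda>c. c # Y c) ps)) ([] @ []) (c # ps) (Bs @ filter (?P c) fs)"
  proof (rule decomp_Cons[OF min_fact_singleton _ Bs(1)])
    show c: "min_fact (c # Y c) (filter (?P c) fs)"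
      using Cons.prems(2) by simp
    from disj have "set (c # Y c) \<inter> set (concat (map (\<lambda>c. c # Y c) ps)) = {}"
      by auto
    then show "distinct ([] @ c # Y c @ concat (map (\<lambda>c. c # Y c) ps))"
      using c decomp_distinct[OF Bs(1)] by (simp add: min_fact_def)
  qed
  ultimately show ?case by auto
qed

text \<open>Without \<sigma> the points fall into one component per point of \<sigma>, and
  minimality passes to each of them. The component of \<open>r\<close>, attached at
  \<open>d\<close>, is kept apart as \<beta> for the recursion. The new list equals
  \<open>xs\<close> only up to rotation, hence the equality of cycles.\<close>

lemma min_fact_peel:
  assumes min: "min_fact xs (\<sigma> # fs)" and r: "r \<in> set xs"
  obtains d W ps ys Bs \<beta> where "decomp ys [] ps Bs" "ys \<noteq> []" "min_fact (d # W) \<beta>" "distinct (d # W @ ys)"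
    "r \<in> set (d # W)" "fs \<sim> Bs @ \<beta>" "cyc (d # W @ ys) = cyc xs" "\<sigma> = cyc (d # ps)"
proof -
  define V where "V = set xs"
  have xs: "distinct xs" and prod: "\<sigma> \<circ> list_prod fs = cyc xs"
    and len: "length xs = Suc (weight (\<sigma> # fs))" and cyc_fs: "\<And>f. f \<in> set fs \<Longrightarrow> cycle_on V f"
    using min by (simp_all add: min_fact_def V_def)
  have "cycle_on V \<sigma>"
    using min by (simp add: min_fact_def V_def)
  then obtain cs where cs: "distinct cs" "2 \<le> length cs" "set cs \<subseteq> V" "\<sigma> = cyc cs" "moved \<sigma> = set cs"
    by (rule cycle_onE)
  have finV: "finite V"
    by (simp add: V_def)
  obtain \<kappa> :: "nat \<Rightarrow> nat" where \<kappa>: "\<And>f x. f \<in> set fs \<Longrightarrow> \<kappa> (f x) = \<kappa> x" "card V \<le> card (\<kappa> ` V) + weight fs"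
    using component_function[of fs V] cyc_fs finV by blast
  define \<pi> where "\<pi> = list_prod fs"
  have \<kappa>\<pi>: "\<kappa> (\<pi> x) = \<kappa> x" for x
    using \<kappa>(1) unfolding \<pi>_def by (rule list_prod_invariant)
  have cardV: "card V = length cs + weight fs"
    using len cs(2,5) distinct_card[OF cs(1)] distinct_card[OF xs] by (simp add: V_def)

  \<comment> \<open>Every component meets the support of \<sigma>: the points in components that do
    are closed under the full cycle.\<close>
  have V_cover: "\<kappa> ` V = \<kappa> ` set cs"
  proof
    obtain c where c: "c \<in> set cs"
      using cs(2) by (cases cs) auto
    have "set xs \<subseteq> {y. \<kappa> y \<in> \<kappa> ` set cs}"
    proof (rule cyc_transitive[OF xs])
      show "c \<in> set xs" "c \<in> {y. \<kappa> y \<in> \<kappa> ` set cs}"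
        using c cs(3) by (auto simp: V_def)
      fix y assume y: "y \<in> {y. \<kappa> y \<in> \<kappa> ` set cs}"
      have "cyc xs y = \<sigma> (\<pi> y)"
        unfolding prod[symmetric] \<pi>_def by simp
      moreover have "\<kappa> (\<sigma> (\<pi> y)) \<in> \<kappa> ` set cs"
      proof (cases "\<pi> y \<in> set cs")
        case True
        then have "\<sigma> (\<pi> y) \<in> set cs"
          using permutes_in_image[OF cycle_permutes[of cs]] cs(4) by simp
        then show ?thesis by simp
      next
        case False
        then show ?thesis
          using y \<kappa>\<pi>[of y] id_outside_supp[of "\<pi> y" cs] cs(4) by simp
      qed
      ultimately show "cyc xs y \<in> {y. \<kappa> y \<in> \<kappa> ` set cs}"
        by simp
    qed
    then show "\<kappa> ` V \<subseteq> \<kappa> ` set cs"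
      by (auto simp: V_def)
  qed (use cs(3) in blast)
  \<comment> \<open>Minimality makes the component count tight, so no two points of \<sigma> share a
    component.\<close>
  have "card (set cs) \<le> card (\<kappa> ` set cs)"
    using \<kappa>(2) cardV V_cover distinct_card[OF cs(1)] by simp
  then have inj: "inj_on \<kappa> (set cs)"
    by (intro eq_card_imp_inj_on) (simp_all add: card_image_le le_antisym)

  define K where "K c = {x \<in> V. \<kappa> x = \<kappa> c}" for c
  let ?fs = "\<lambda>c. filter (\<lambda>f. moved f \<subseteq> K c) fs"
  have K_disj: "K c \<inter> K d = {}" if "c \<in> set cs" "d \<in> set cs" "c \<noteq> d" for c d
    using inj that by (auto simp: K_def inj_on_def)
  have K_cs: "x = c" if "x \<in> set cs" "c \<in> set cs" "x \<in> K c" for x c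
    using inj that by (auto simp: K_def inj_on_def)
  have K_fin: "finite (K c)" for c
    using finV by (simp add: K_def)
  have one_class: "\<kappa> y = \<kappa> x" if f: "f \<in> set fs" and "x \<in> moved f" "y \<in> moved f" for f x y
  proof -
    from cyc_fs[OF f] obtain ds where ds: "distinct ds" "f = cyc ds" "moved f = set ds"
      by (rule cycle_onE)
    have "set ds \<subseteq> {y. \<kappa> y = \<kappa> x}"
      by (rule cyc_transitive[OF ds(1), of x]) (use that ds \<kappa>(1)[OF f] in auto)
    with that ds(3) show ?thesis by auto
  qed
  have mv: "moved f \<subseteq> V" "moved f \<noteq> {}" if "f \<in> set fs" for f
    using cycle_on_moved(1,3)[OF cyc_fs[OF that]] by auto
  have in_K: "\<exists>!c. c \<in> set cs \<and> moved f \<subseteq> K c" if f: "f \<in> set fs" for f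
  proof -
    obtain x where x: "x \<in> moved f"
      using mv(2)[OF f] by blast
    then have "\<kappa> x \<in> \<kappa> ` set cs"
      using mv(1)[OF f] V_cover by blast
    then obtain c where c: "c \<in> set cs" "\<kappa> x = \<kappa> c"
      by blast
    have "moved f \<subseteq> K c"
      using one_class[OF f x] mv(1)[OF f] c(2) by (auto simp: K_def)
    then show ?thesis
      using c(1) K_disj x by blast
  qed
  have sep: "moved f \<subseteq> K c \<or> moved f \<inter> K c = {}" if f: "f \<in> set fs" for f c
  proof (rule disjCI)
    assume "moved f \<inter> K c \<noteq> {}"
    then obtain x where x: "x \<in> moved f" "\<kappa> x = \<kappa> c"
      by (auto simp: K_def)
    show "moved f \<subseteq> K c"
      using one_class[OF f x(1)] mv(1)[OF f] x(2) by (auto simp: K_def)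
  qed

  have ex_Y: "\<exists>Y. distinct (c # Y) \<and> set (c # Y) = K c \<and> list_prod (?fs c) = cyc (c # Y)" if c: "c \<in> set cs" for c
  proof -
    define p where "p = list_prod (?fs c)"
    have p_perm: "p permutes K c"
      unfolding p_def
    proof (rule list_prod_permutes)
      fix f assume "f \<in> set (?fs c)"
      then show "f permutes K c"
        using cyc_fs by (intro cycle_on_permutes cycle_on_subset[of V f "K c"]) auto
    qed
    then have perm: "permutation p"
      using K_fin permutation_permutes by blast
    have p_eq: "\<pi> x = p x" if "x \<in> K c" for x
      using list_prod_filter[of fs V "K c" x] cyc_fs sep that unfolding \<pi>_def p_def by blast
    have cK: "c \<in> K c"
      using c cs(3) by (auto simp: K_def)
    \<comment> \<open>An orbit inside \<open>K c\<close> that misses \<open>c\<close> misses all of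
      \<open>cs\<close>. Then \<sigma> fixes it pointwise and the orbit is closed under the full
      cycle, which is absurd.\<close>
    have "x \<in> range (\<lambda>i. (p ^^ i) c)" if x: "x \<in> K c" for x
    proof (rule ccontr)
      let ?O = "range (\<lambda>i. (p ^^ i) x)"
      assume "x \<notin> range (\<lambda>i. (p ^^ i) c)"
      then have "?O \<inter> range (\<lambda>i. (p ^^ i) c) = {}"
        using disjoint_support'[OF perm, of x c] support_set[OF perm] by simp
      moreover have "c \<in> range (\<lambda>i. (p ^^ i) c)"
        by (metis funpow_0 rangeI)
      ultimately have cO: "c \<notin> ?O"
        by blast
      have OK: "?O \<subseteq> K c"
        using permutes_in_image[OF permutes_funpow[OF p_perm]] x by blast
      have "set xs \<subseteq> ?O"
      proof (rule cyc_transitive[OF xs])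
        show "x \<in> set xs"
          using x by (simp add: K_def V_def)
        show "x \<in> ?O"
          by (metis funpow_0 rangeI)
        fix y assume y: "y \<in> ?O"
        then obtain i where "y = (p ^^ i) x"
          by blast
        then have "p y = (p ^^ Suc i) x"
          by simp
        then have pO: "p y \<in> ?O"
          by (rule range_eqI)
        have "p y \<notin> set cs"
        proof
          assume "p y \<in> set cs"
          with pO OK have "p y = c"
            by (intro K_cs[OF _ c]) auto
          with pO cO show False by simp
        qed
        then have "\<sigma> (p y) = p y"
          using cs(4) id_outside_supp by simp
        moreover have "cyc xs y = \<sigma> (p y)"
        proof -
          have "y \<in> K c"
            using y OK by blast
          then show ?thesis
            using p_eq[of y] unfolding prod[symmetric] \<pi>_def by simp
        qed
        ultimately show "cyc xs y \<in> ?O"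
          using pO by simp
      qed
      with cO c cs(3) show False
        by (auto simp: V_def)
    qed
    with p_perm K_fin cK show ?thesis
      using cyc_of_transitive[of p "K c" c] unfolding p_def by metis
  qed
  then have "\<forall>c\<in>set cs. \<exists>Y. distinct (c # Y) \<and> set (c # Y) = K c \<and> list_prod (?fs c) = cyc (c # Y)"
    by blast
  from bchoice[OF this] obtain Y where "\<forall>c\<in>set cs. distinct (c # Y c) \<and> set (c # Y c) = K c
      \<and> list_prod (?fs c) = cyc (c # Y c)"
    by blast
  then have Y: "\<And>c. c \<in> set cs \<Longrightarrow> distinct (c # Y c)" "\<And>c. c \<in> set cs \<Longrightarrow> set (c # Y c) = K c"
    "\<And>c. c \<in> set cs \<Longrightarrow> list_prod (?fs c) = cyc (c # Y c)"
    by blast+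
  have cyc_K: "cycle_on (set (c # Y c)) f" if "c \<in> set cs" "f \<in> set (?fs c)" for c f
    unfolding Y(2)[OF that(1)] by (rule cycle_on_subset[OF cyc_fs]) (use that(2) in auto)
  have len_Y: "length (c # Y c) = card (K c)" if "c \<in> set cs" for c
    using distinct_card[OF Y(1)[OF that]] Y(2)[OF that] by simp
  have le: "card (K c) \<le> Suc (weight (?fs c))" if c: "c \<in> set cs" for c
    using length_le_weight[OF Y(1)[OF c] cyc_K[OF c] Y(3)[OF c]] len_Y[OF c] by simp
  have "(\<Sum>c\<in>set cs. card (K c)) = card (\<Union>c\<in>set cs. K c)"
    using K_fin K_disj by (intro card_UN_disjoint[symmetric]) auto
  also have "(\<Union>c\<in>set cs. K c) = V"
    using V_cover by (auto simp: K_def)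
  also have "card V = (\<Sum>c\<in>set cs. Suc (weight (?fs c)))"
    using cardV weight_partition[of "set cs" fs "\<lambda>c f. moved f \<subseteq> K c"] in_K distinct_card[OF cs(1)]
    by (simp add: sum_Suc)
  \<comment> \<open>The bound \<open>le\<close> holds in each component and the sums agree, so it is
    an equality everywhere.\<close>
  finally have "card (K c) = Suc (weight (?fs c))" if "c \<in> set cs" for c
    using sum_mono_inv[of "\<lambda>c. card (K c)" "set cs" "\<lambda>c. Suc (weight (?fs c))"] le that by simp
  then have min_K: "min_fact (c # Y c) (?fs c)" if "c \<in> set cs" for c
    using that Y(1,3) cyc_K len_Y unfolding min_fact_def by metis

  have "\<kappa> r \<in> \<kappa> ` set cs"
    using r V_cover by (auto simp: V_def)
  then obtain d where d: "d \<in> set cs" "r \<in> K d"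
    using r by (auto simp: K_def V_def)
  obtain u v where uv: "cs = u @ d # v"
    using d(1) by (meson split_list)
  define ps where "ps = v @ u"
  have \<sigma>: "\<sigma> = cyc (d # ps)"
    using cs(1,4) cyc_append_commute[of u "d # v"] unfolding uv ps_def by simp
  have set_ps: "set cs = insert d (set ps)" and dist_ps: "distinct (d # ps)"
    using cs(1) unfolding uv ps_def by auto
  have "ps \<noteq> []"
    using cs(2) unfolding uv ps_def by auto
  define fs\<^sub>1 where "fs\<^sub>1 = filter (\<lambda>f. \<not> moved f \<subseteq> K d) fs"
  define ys where "ys = concat (map (\<lambda>c. c # Y c) ps)"
  have fs_equiv: "fs \<sim> fs\<^sub>1 @ ?fs d"
    unfolding fs\<^sub>1_def
  proof (rule fact_equiv_filter)
    fix f g assume fg: "f \<in> set fs" "g \<in> set fs" "moved f \<subseteq> K d" "\<not> moved g \<subseteq> K d"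
    then have "moved f \<inter> moved g = {}"
      using sep[of g d] by blast
    then show "f \<circ> g = g \<circ> f"
      using cycle_on_commute cyc_fs fg(1,2) by blast
  qed
  have "\<exists>Bs. decomp ys [] ps Bs \<and> fs\<^sub>1 \<sim> Bs"
    unfolding ys_def
  proof (rule decomp_assemble)
    show "distinct ps"
      using dist_ps by simp
    have cs_ps: "c \<in> set cs" if "c \<in> set ps" for c
      using that set_ps by simp
    show "min_fact (c # Y c) (filter (\<lambda>f. moved f \<subseteq> set (c # Y c)) fs\<^sub>1)" if c: "c \<in> set ps" for c
    proof -
      have "d \<noteq> c"
        using c dist_ps by auto
      then have "filter (\<lambda>f. moved f \<subseteq> K c) fs\<^sub>1 = ?fs c"
        using K_disj[OF d(1) cs_ps[OF c]] mv(2) unfolding fs\<^sub>1_def filter_filter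
        by (intro filter_cong) blast+
      with min_K[OF cs_ps[OF c]] Y(2)[OF cs_ps[OF c]] show ?thesis by simp
    qed
    show "set (c # Y c) \<inter> set (e # Y e) = {}" if "c \<in> set ps" "e \<in> set ps" "c \<noteq> e" for c e
      using K_disj Y(2) cs_ps that by metis
    show "cycle_on V f \<and> (\<exists>c\<in>set ps. moved f \<subseteq> set (c # Y c))" if "f \<in> set fs\<^sub>1" for f
    proof -
      have f: "f \<in> set fs" "\<not> moved f \<subseteq> K d"
        using that by (auto simp: fs\<^sub>1_def)
      then obtain c where "c \<in> set ps" "moved f \<subseteq> K c"
        using in_K[OF f(1)] set_ps by auto
      then show ?thesis
        using cyc_fs[OF f(1)] Y(2) cs_ps by metis
    qed
  qed
  then obtain Bs where Bs: "decomp ys [] ps Bs" "fs\<^sub>1 \<sim> Bs"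
    by blast
  have "fs\<^sub>1 @ ?fs d \<sim> Bs @ ?fs d"
    using Bs(2) by (intro fact_equiv_append) simp_all
  with fs_equiv have fs: "fs \<sim> Bs @ ?fs d"
    by (rule fact_equiv_trans)
  have "ys \<noteq> []"
    using \<open>ps \<noteq> []\<close> by (cases ps) (auto simp: ys_def)
  have "set (d # Y d) \<inter> set (c # Y c) = {}" if "c \<in> set ps" for c
  proof -
    have "c \<in> set cs" "d \<noteq> c"
      using that set_ps dist_ps by auto
    then show ?thesis
      using K_disj[OF d(1)] Y(2) d(1) by metis
  qed
  then have "set (d # Y d) \<inter> set ys = {}"
    by (auto simp: ys_def)
  then have dist: "distinct (d # Y d @ ys)"
    using Y(1)[OF d(1)] decomp_distinct[OF Bs(1)] by auto
  \<comment> \<open>Reassembling the pieces is the way to learn the cyclic order of the concatenated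
    list: both products are the same permutation.\<close>
  have "min_fact (d # Y d @ ys) ([] @ [cyc (d # ps)] @ Bs @ ?fs d)"
    by (rule min_fact_of_decomp[OF Bs(1) \<open>ys \<noteq> []\<close> min_K[OF d(1)] dist])
  then have "cyc (d # Y d @ ys) = \<sigma> \<circ> list_prod (Bs @ ?fs d)"
    by (simp add: min_fact_def \<sigma>)
  also have "list_prod (Bs @ ?fs d) = list_prod fs"
    using fact_equiv_invariants(1)[OF fs] by simp
  finally have "cyc (d # Y d @ ys) = cyc xs"
    using prod by simp
  moreover have "r \<in> set (d # Y d)"
    using d Y(2)[OF d(1)] by simp
  ultimately show thesis
    using that[OF Bs(1) \<open>ys \<noteq> []\<close> min_K[OF d(1)] dist _ fs _ \<sigma>] by blast
qed

text \<open>If the leftmost factor moves \<open>r\<close>, it is the root cycle and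
  \<open>As\<close> is empty. Otherwise \<open>r\<close> lies in the component \<beta>, which has
  fewer factors and is split by induction; the peeled star is then grafted at
  \<open>d\<close>.\<close>

lemma min_fact_decomp:
  assumes "min_fact (r # w) fs" "w \<noteq> []"
  shows "\<exists>Y xs As ps Bs \<beta>. w = Y @ xs \<and> xs \<noteq> [] \<and> decomp xs As ps Bs \<and> min_fact (r # Y) \<beta>
    \<and> fs \<sim> As @ [cyc (r # ps)] @ Bs @ \<beta>"
  using assms
proof (induction "length fs" arbitrary: w fs rule: less_induct)
  case less
  have dist_w: "distinct (r # w)"
    using less.prems(1) by (simp add: min_fact_def)
  obtain \<sigma> fs' where fs: "fs = \<sigma> # fs'"
    using less.prems by (cases fs) (auto simp: min_fact_def)
  have "r \<in> set (r # w)"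
    by simp
  with less.prems(1)[unfolded fs] obtain d W ps ys Bs \<beta> where
    dec: "decomp ys [] ps Bs" and ys: "ys \<noteq> []" and W: "min_fact (d # W) \<beta>" and dist: "distinct (d # W @ ys)"
    and r: "r \<in> set (d # W)" and fs': "fs' \<sim> Bs @ \<beta>" and cyc_eq: "cyc (d # W @ ys) = cyc (r # w)"
    and \<sigma>: "\<sigma> = cyc (d # ps)"
    by (rule min_fact_peel)
  have fs_equiv: "fs \<sim> (cyc (d # ps) # Bs) @ \<beta>"
    using fact_equiv_Cons[OF fs'] by (simp add: fs \<sigma>)
  show ?case
  proof (cases "r = d")
    case True
    have "w = W @ ys"
      by (rule cyc_inject[OF dist_w dist[folded True] cyc_eq[folded True, symmetric]])
    then show ?thesis
      using dec ys W fs_equiv True by (intro exI[of _ W] exI[of _ ys] exI[of _ "[]"] exI[of _ ps] exI[of _ Bs] exI[of _ \<beta>]) simp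
  next
    case False
    with r obtain W\<^sub>1 W\<^sub>2 where W12: "W = W\<^sub>1 @ r # W\<^sub>2"
      by (metis set_ConsD split_list)
    \<comment> \<open>The peeled factor with everything at its points other than \<open>d\<close>:
      by itself a minimal factorization on \<open>d # ys\<close>.\<close>
    define G where "G = cyc (d # ps) # Bs"
    have "cyc ((d # W\<^sub>1) @ (r # W\<^sub>2 @ ys)) = cyc ((r # W\<^sub>2 @ ys) @ (d # W\<^sub>1))"
      by (rule cyc_append_commute) (use dist W12 in auto)
    then have "cyc (r # W\<^sub>2 @ ys @ d # W\<^sub>1) = cyc (r # w)"
      using cyc_eq W12 by simp
    moreover have dist2: "distinct (r # W\<^sub>2 @ ys @ d # W\<^sub>1)"
      using dist W12 by auto
    ultimately have w: "w = W\<^sub>2 @ ys @ d # W\<^sub>1"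
      using cyc_inject[OF dist2 dist_w] by simp
    have "min_fact (d # [] @ ys) ([] @ [cyc (d # ps)] @ Bs @ [])"
      by (rule min_fact_of_decomp[OF dec ys min_fact_singleton]) (use dist in auto)
    then have G: "min_fact (d # ys) G"
      by (simp add: G_def)
    have G_cyc: "cycle_on (set (d # ys)) g" if "g \<in> set G" for g
      using G that by (simp add: min_fact_def)
    have "min_fact ((r # W\<^sub>2) @ (d # W\<^sub>1)) \<beta>"
      by (rule min_fact_rotate) (use W W12 in simp)
    then have \<beta>: "min_fact (r # W\<^sub>2 @ d # W\<^sub>1) \<beta>"
      by simp
    have "length fs' = length (Bs @ \<beta>)"
      using fact_equiv_invariants(2)[OF fs'] by (metis size_mset)
    then have "length \<beta> < length fs"
      by (simp add: fs)
    then obtain Y xs As qs Cs \<gamma> where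
      split: "W\<^sub>2 @ d # W\<^sub>1 = Y @ xs" and xs: "xs \<noteq> []" and dec': "decomp xs As qs Cs"
      and \<gamma>: "min_fact (r # Y) \<gamma>" and \<beta>_equiv: "\<beta> \<sim> As @ [cyc (r # qs)] @ Cs @ \<gamma>"
      using less.hyps[OF _ \<beta>] by blast
    have "G @ \<beta> \<sim> G @ As @ [cyc (r # qs)] @ Cs @ \<gamma>"
      using fact_equiv_append[OF fact_equiv_refl[of G] \<beta>_equiv] .
    with fs_equiv have fs_equiv': "fs \<sim> G @ As @ [cyc (r # qs)] @ Cs @ \<gamma>"
      unfolding G_def by (rule fact_equiv_trans)
    have qs: "set qs \<subseteq> set xs" "distinct qs" "qs \<noteq> []"
      using decomp_points[OF dec'] xs by auto
    have sets: "set Y \<union> set xs = set W\<^sub>2 \<union> insert d (set W\<^sub>1)"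
      using arg_cong[OF split, of set] by auto
    have distYx: "distinct (Y @ xs)"
      using dist2 unfolding split[symmetric] by auto
    have fresh: "r \<notin> set Y" "r \<notin> set xs" "set ys \<inter> (set Y \<union> set xs) = {}" "r \<notin> set (d # ys)"
      using dist2 sets by auto
    have p_cyc: "cycle_on (set (r # qs)) (cyc (r # qs))"
      by (rule cycle_on_cyc) (use qs fresh in \<open>auto simp: Suc_le_eq\<close>)
    have "d \<notin> set W\<^sub>2" "d \<notin> set W\<^sub>1"
      using dist2 by auto
    then have uniq: "W\<^sub>2 = u \<and> W\<^sub>1 = v" if "W\<^sub>2 @ d # W\<^sub>1 = u @ d # v" for u v
      using append_Cons_eq_iff[of d W\<^sub>2 W\<^sub>1 u v] that by blast
    consider "d \<in> set Y" | "d \<in> set xs"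
      using sets by auto
    then show ?thesis
    proof cases
      case 1
      then obtain Y\<^sub>1 Y\<^sub>2 where Y: "Y = Y\<^sub>1 @ d # Y\<^sub>2"
        by (meson split_list)
      have W_eq: "W\<^sub>2 = Y\<^sub>1 \<and> W\<^sub>1 = Y\<^sub>2 @ xs"
        by (rule uniq) (simp add: split Y)
      have "d \<notin> set xs"
        using 1 distYx by auto
      then have disj: "set (d # ys) \<inter> set xs = {}"
        using fresh(3) by auto
      \<comment> \<open>The graft point hangs below \<open>r\<close> itself, so \<open>G\<close>
        slides past the root cycle and joins \<gamma>.\<close>
      have "g \<circ> f = f \<circ> g" if g: "g \<in> set G" and f: "f \<in> set (As @ [cyc (r # qs)] @ Cs)" for f g
      proof -
        from f consider "f \<in> set As \<union> set Cs" | "f = cyc (r # qs)"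
          by auto
        then show ?thesis
        proof cases
          case 1
          show ?thesis
            by (rule cycle_on_commute_disjoint[OF G_cyc[OF g] decomp_cycle_on[OF dec' 1] disj])
        next
          case 2
          show ?thesis
            unfolding 2
            by (rule cycle_on_commute_disjoint[OF G_cyc[OF g] p_cyc]) (use disj qs(1) fresh(4) in auto)
        qed
      qed
      then have "G @ As @ [cyc (r # qs)] @ Cs \<sim> (As @ [cyc (r # qs)] @ Cs) @ G"
        by (rule fact_equiv_commute)
      from fact_equiv_append[OF this fact_equiv_refl[of \<gamma>]]
      have "G @ As @ [cyc (r # qs)] @ Cs @ \<gamma> \<sim> As @ [cyc (r # qs)] @ Cs @ G @ \<gamma>"
        by simp
      with fs_equiv' have "fs \<sim> As @ [cyc (r # qs)] @ Cs @ G @ \<gamma>"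
        by (rule fact_equiv_trans)
      moreover have "min_fact ((r # Y\<^sub>1) @ ys @ d # Y\<^sub>2) (G @ \<gamma>)"
        by (rule min_fact_graft) (use \<gamma> G Y W_eq dist2 in auto)
      then have "min_fact (r # Y\<^sub>1 @ ys @ d # Y\<^sub>2) (G @ \<gamma>)"
        by simp
      moreover have "w = (Y\<^sub>1 @ ys @ d # Y\<^sub>2) @ xs"
        using w W_eq by simp
      ultimately show ?thesis
        using xs dec' by blast
    next
      case 2
      then obtain x\<^sub>1 x\<^sub>2 where x: "xs = x\<^sub>1 @ d # x\<^sub>2"
        by (meson split_list)
      have W_eq: "W\<^sub>2 = Y @ x\<^sub>1 \<and> W\<^sub>1 = x\<^sub>2"
        by (rule uniq) (simp add: split x)
      \<comment> \<open>Off the root polygon, \<open>d # ys\<close> is disjoint from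
        \<open>r # qs\<close>; this is the side condition of \<open>decomp_insert\<close>.\<close>
      have "g \<circ> m = m \<circ> g" if "d \<notin> set qs" "g \<in> set G" "m \<in> set [cyc (r # qs)]" for g m
      proof -
        have "m = cyc (r # qs)"
          using that(3) by simp
        then show ?thesis
          by (simp only:, intro cycle_on_commute_disjoint[OF G_cyc[OF that(2)] p_cyc])
            (use that(1) qs(1) fresh in auto)
      qed
      moreover have "distinct (x\<^sub>1 @ ys @ d # x\<^sub>2)"
        using dist2 W_eq by auto
      ultimately obtain As' Cs' where ins: "decomp (x\<^sub>1 @ ys @ d # x\<^sub>2) As' qs Cs'"
        "G @ As @ [cyc (r # qs)] @ Cs \<sim> As' @ [cyc (r # qs)] @ Cs'"
        using decomp_insert[OF dec' G x] by blast
      from fact_equiv_append[OF ins(2) fact_equiv_refl[of \<gamma>]]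
      have "G @ As @ [cyc (r # qs)] @ Cs @ \<gamma> \<sim> As' @ [cyc (r # qs)] @ Cs' @ \<gamma>"
        by simp
      with fs_equiv' have "fs \<sim> As' @ [cyc (r # qs)] @ Cs' @ \<gamma>"
        by (rule fact_equiv_trans)
      moreover have "w = Y @ x\<^sub>1 @ ys @ d # x\<^sub>2"
        using w W_eq by simp
      ultimately show ?thesis
        using ins(1) \<gamma> by blast
    qed
  qed
qed

section \<open>Building the tree by recursion on the number of points\<close>

lemma decomp_reps:
  assumes "decomp xs As ps Bs"
    and "\<And>ys fs. length ys \<le> length xs \<Longrightarrow> min_fact ys fs \<Longrightarrow> \<exists>T gs. rep T ys gs \<and> fs \<sim> gs"
  shows "\<exists>ts As' Bs'. reps ts xs As' ps Bs' \<and> As \<sim> As' \<and> Bs \<sim> Bs'"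
  using assms
proof (induction rule: decomp.induct)
  case decomp_Nil
  show ?case
    by (intro exI[of _ "[]"]) (simp add: reps_Nil)
next
  case (decomp_Cons a Z \<alpha> Y \<beta> xs As ps Bs)
  have "\<exists>ts As' Bs'. reps ts xs As' ps Bs' \<and> As \<sim> As' \<and> Bs \<sim> Bs'"
    by (rule decomp_Cons.IH, rule decomp_Cons.prems) auto
  then obtain ts As' Bs' where ts: "reps ts xs As' ps Bs'" "As \<sim> As'" "Bs \<sim> Bs'"
    by blast
  have "\<exists>T gs. rep T (a # Z) gs \<and> \<alpha> \<sim> gs"
    by (rule decomp_Cons.prems[OF _ decomp_Cons.hyps(1)]) simp
  then obtain A \<alpha>' where A: "rep A (a # Z) \<alpha>'" "\<alpha> \<sim> \<alpha>'"
    by blast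
  have "\<exists>T gs. rep T (a # Y) gs \<and> \<beta> \<sim> gs"
    by (rule decomp_Cons.prems[OF _ decomp_Cons.hyps(2)]) simp
  then obtain B \<beta>' where B: "rep B (a # Y) \<beta>'" "\<beta> \<sim> \<beta>'"
    by blast
  show ?case
    using reps_Cons[OF A(1) B(1) ts(1)] fact_equiv_append[OF A(2) ts(2)] fact_equiv_append[OF ts(3) B(2)]
    by blast
qed

lemma min_fact_rep:
  assumes "min_fact xs fs"
  shows "\<exists>T gs. rep T xs gs \<and> fs \<sim> gs"
  using assms
proof (induction "length xs" arbitrary: xs fs rule: less_induct)
  case less
  obtain r w where xs: "xs = r # w"
    using less.prems by (cases xs) (auto simp: min_fact_def)
  show ?case
  proof (cases "w = []")
    case True
    with xs have "fs = []"
      using min_fact_length[OF less.prems] by simp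
    with True xs rep_leaf show ?thesis
      by (intro exI[of _ "Node []"] exI[of _ "[]"]) simp
  next
    case False
    with min_fact_decomp[of r w fs] less.prems xs obtain Y ys As ps Bs \<beta> where
      w: "w = Y @ ys" "ys \<noteq> []" and dec: "decomp ys As ps Bs" and \<beta>: "min_fact (r # Y) \<beta>"
      and fs: "fs \<sim> As @ [cyc (r # ps)] @ Bs @ \<beta>"
      by blast
    have "\<exists>T gs. rep T zs gs \<and> hs \<sim> gs" if "length zs \<le> length ys" "min_fact zs hs" for zs hs
      by (rule less.hyps[OF _ that(2)]) (use that(1) xs w in simp)
    from decomp_reps[OF dec this] obtain ts As' Bs' where
      ts: "reps ts ys As' ps Bs'" "As \<sim> As'" "Bs \<sim> Bs'"
      by blast
    have "\<exists>T gs. rep T (r # Y) gs \<and> \<beta> \<sim> gs"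
      by (rule less.hyps[OF _ \<beta>]) (use xs w in simp)
    then obtain B \<beta>' where B: "rep B (r # Y) \<beta>'" "\<beta> \<sim> \<beta>'"
      by blast
    have "ts \<noteq> []"
      using ts(1) w(2) by (auto elim: reps.cases)
    from rep_node[OF B(1) ts(1) this]
    have "rep (Node (B # ts)) xs (As' @ [cyc (r # ps)] @ Bs' @ \<beta>')"
      using xs w(1) by simp
    moreover have "As @ [cyc (r # ps)] @ Bs @ \<beta> \<sim> As' @ [cyc (r # ps)] @ Bs' @ \<beta>'"
      by (intro fact_equiv_append ts B fact_equiv_refl)
    with fs have "fs \<sim> As' @ [cyc (r # ps)] @ Bs' @ \<beta>'"
      by (rule fact_equiv_trans)
    ultimately show ?thesis by blast
  qed
qed

section \<open>The correspondence\<close>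

lemma is_cycle_of_len_iff:
  assumes "2 \<le> j"
  shows "is_cycle_of_len n j f \<longleftrightarrow> cycle_on {1..n} f \<and> card (moved f) = j"
proof
  assume "is_cycle_of_len n j f"
  then obtain cs where "distinct cs" "length cs = j" "set cs \<subseteq> {1..n}" "f = cyc cs"
    by (auto simp: is_cycle_of_len_def)
  with assms show "cycle_on {1..n} f \<and> card (moved f) = j"
    using cycle_on_cyc[of cs "{1..n}"] moved_cyc[of cs] distinct_card[of cs] by simp
next
  assume f: "cycle_on {1..n} f \<and> card (moved f) = j"
  then obtain cs where "distinct cs" "set cs \<subseteq> {1..n}" "f = cyc cs" "moved f = set cs"
    by (elim conjE cycle_onE)
  with f show "is_cycle_of_len n j f"
    unfolding is_cycle_of_len_def using distinct_card[of cs] by auto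
qed

definition factor_count :: "(nat \<Rightarrow> nat) list \<Rightarrow> nat \<Rightarrow> nat" where
  "factor_count fs j = length (filter (\<lambda>f. card (moved f) = j) fs)"

lemma factor_count_cong: "mset fs = mset gs \<Longrightarrow> factor_count fs j = factor_count gs j"
  unfolding factor_count_def by (metis mset_filter size_mset)

lemma weight_filter: "weight (filter (\<lambda>f. card (moved f) = j) fs) = (j - 1) * factor_count fs j"
  by (induction fs) (auto simp: factor_count_def)

text \<open>Minimality is not written into \<open>factorizations\<close>: it follows from the type,
  since sorting the factors by length gives weight n-1.\<close>

lemma factorizations_iff:
  assumes "n \<ge> 1" "finite {j. 2 \<le> j \<and> \<alpha> j \<noteq> 0}"
    and "(\<Sum>j\<in>{j. 2 \<le> j \<and> \<alpha> j \<noteq> 0}. (j - 1) * \<alpha> j) = n - 1"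
  shows "fs \<in> factorizations n \<alpha> \<longleftrightarrow> min_fact [1..<n+1] fs \<and> (\<forall>j\<ge>2. factor_count fs j = \<alpha> j)"
proof -
  let ?J = "{j. 2 \<le> j \<and> \<alpha> j \<noteq> 0}"
  have set_upt: "set [1..<n+1] = {1..n}"
    by auto
  have all_cycle: "(\<forall>f\<in>set fs. \<exists>j\<ge>2. is_cycle_of_len n j f) \<longleftrightarrow> (\<forall>f\<in>set fs. cycle_on {1..n} f)"
    using is_cycle_of_len_iff cycle_on_moved(3) by metis
  have count: "length (filter (is_cycle_of_len n j) fs) = factor_count fs j"
    if "\<forall>f\<in>set fs. cycle_on {1..n} f" "2 \<le> j" for j
    unfolding factor_count_def using that is_cycle_of_len_iff[OF that(2), of n]
    by (metis (mono_tags, lifting) filter_cong)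
  have "Suc (weight fs) = n" if cyc: "\<forall>f\<in>set fs. cycle_on {1..n} f" and cnt: "\<forall>j\<ge>2. factor_count fs j = \<alpha> j"
  proof -
    have "card (moved f) \<in> ?J" if f: "f \<in> set fs" for f
    proof -
      have two: "2 \<le> card (moved f)"
        using cyc f cycle_on_moved(3) by blast
      have "f \<in> set (filter (\<lambda>g. card (moved g) = card (moved f)) fs)"
        using f by simp
      then have "factor_count fs (card (moved f)) \<noteq> 0"
        unfolding factor_count_def by (metis length_0_conv list.set(1) empty_iff)
      with cnt two show ?thesis by simp
    qed
    then have "weight fs = (\<Sum>j\<in>?J. weight (filter (\<lambda>f. card (moved f) = j) fs))"
      by (intro weight_partition assms(2)) auto
    also have "\<dots> = (\<Sum>j\<in>?J. (j - 1) * \<alpha> j)"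
      by (rule sum.cong) (use cnt weight_filter in auto)
    finally show ?thesis
      using assms(1,3) by simp
  qed
  then show ?thesis
    unfolding factorizations_def min_fact_def long_cycle_def set_upt
    using all_cycle count by auto
qed

lemma count_factor_degs: "count (factor_degs fs) (2 * j) = factor_count fs j"
  by (induction fs) (auto simp: factor_count_def)

lemma rep_tree_of_type_iff:
  assumes "rep t [1..<n+1] fs"
  shows "Node [t] \<in> trees_of_type n \<alpha> \<longleftrightarrow> (\<forall>j\<ge>2. factor_count fs j = \<alpha> j)"
proof -
  have degs: "tree_degs (Node [t]) = factor_degs fs + replicate_mset (2 * n) 1"
    using rep_degs[OF assms] by simp
  have min: "min_fact [1..<n+1] fs"
    using rep_sound[OF assms] by simp
  have "count (tree_degs (Node [t])) 1 = 2 * n"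
    unfolding degs using count_one_factor_degs[of fs] by simp
  moreover have "count (tree_degs (Node [t])) (2 * j) = factor_count fs j" for j
    unfolding degs using count_factor_degs[of fs j] by simp
  moreover have "d = 1 \<or> (\<exists>j\<ge>2. d = 2 * j)" if "d \<in># tree_degs (Node [t])" for d
    using that min_fact_moved(2)[OF min] unfolding degs by (auto split: if_splits)
  ultimately show ?thesis
    unfolding trees_of_type_def by (simp del: tree_degs.simps)
qed

text \<open>The degree condition gives an encoded list of some length; the 2n leaves force this
  length to be n.\<close>

lemma tree_of_type_rep:
  assumes "T \<in> trees_of_type n \<alpha>"
  obtains t fs where "T = Node [t]" "rep t [1..<n+1] fs"
proof -
  obtain t where T: "T = Node [t]" and leaves: "count (tree_degs T) 1 = 2 * n"
    and degs: "\<forall>d\<in>#tree_degs T. d = 1 \<or> (\<exists>j\<ge>2. d = 2 * j)"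
    using assms by (auto simp: trees_of_type_def)
  have "\<forall>d\<in>#degs_below t. d = 1 \<or> (\<exists>j\<ge>2. d = 2 * j)"
    using degs T by simp
  then obtain m where m: "\<forall>xs. length xs = Suc m \<longrightarrow> (\<exists>fs. rep t xs fs)"
    using rep_exists by blast
  then obtain fs where fs: "rep t [1..<Suc m+1] fs"
    by (metis add_diff_cancel_right' length_upt)
  then have "count (tree_degs T) 1 = 2 * Suc m"
    using rep_degs[OF fs] count_one_factor_degs[of fs] T by (simp del: tree_degs.simps)
  with leaves have "n = Suc m"
    by simp
  with fs T that show thesis by blast
qed

theorem theorem1:
  fixes n :: nat and \<alpha> :: "nat \<Rightarrow> nat"
  assumes "n \<ge> 1"
    and "finite {j. 2 \<le> j \<and> \<alpha> j \<noteq> 0}"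
    and "(\<Sum>j\<in>{j. 2 \<le> j \<and> \<alpha> j \<noteq> 0}. (j - 1) * \<alpha> j) = n - 1"
  shows "\<exists>g. bij_betw g (factorizations n \<alpha> // fact_equiv) (trees_of_type n \<alpha>)"
proof -
  let ?X = "[1..<n+1]"
  have dist: "distinct ?X"
    by simp
  note fact_iff = factorizations_iff[OF assms]
  \<comment> \<open>The choice is harmless, as \<open>rep\<close> is functional. The map runs from
    trees to classes, so no representative of a class has to be chosen.\<close>
  define R where "R T = (SOME fs. \<exists>t. T = Node [t] \<and> rep t ?X fs)" for T
  define h where "h T = fact_equiv `` {R T}" for T
  have R_eq: "R (Node [t]) = fs" if fs: "rep t ?X fs" for t fs
    unfolding R_def
  proof (rule some_equality)
    fix gs assume "\<exists>t'. Node [t] = Node [t'] \<and> rep t' ?X gs"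
    then have "rep t ?X gs" by simp
    then show "gs = fs"
      using rep_functional[OF fs] dist by simp
  qed (use fs in simp)
  have "bij_betw h (trees_of_type n \<alpha>) (factorizations n \<alpha> // fact_equiv)"
    unfolding bij_betw_def
  proof (intro conjI subset_antisym inj_onI subsetI)
    fix T T' assume "T \<in> trees_of_type n \<alpha>" "T' \<in> trees_of_type n \<alpha>" and eq: "h T = h T'"
    then obtain t fs t' fs' where T: "T = Node [t]" "rep t ?X fs" "T' = Node [t']" "rep t' ?X fs'"
      by (meson tree_of_type_rep)
    with eq have "fact_equiv `` {fs} = fact_equiv `` {fs'}"
      by (simp add: h_def R_eq)
    then have "fs \<sim> fs'"
      using eq_equiv_class[OF _ equiv_fact_equiv] by blast
    \<comment> \<open>Injectivity forgets everything about the class except its set of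
      factors.\<close>
    then have "set fs = set fs'"
      using fact_equiv_invariants(2) by (metis set_mset_mset)
    then have "t = t'"
      using rep_inject[OF T(2)] T(4) dist by blast
    with T show "T = T'" by simp
  next
    fix Q assume "Q \<in> h ` trees_of_type n \<alpha>"
    then obtain T where T: "T \<in> trees_of_type n \<alpha>" "Q = h T"
      by blast
    obtain t fs where t: "T = Node [t]" "rep t ?X fs"
      using tree_of_type_rep[OF T(1)] by blast
    have "fs \<in> factorizations n \<alpha>"
      using fact_iff rep_sound[OF t(2)] dist rep_tree_of_type_iff[OF t(2)] T(1) t(1) by simp
    then show "Q \<in> factorizations n \<alpha> // fact_equiv"
      unfolding T(2) h_def t(1) R_eq[OF t(2)] by (rule quotientI)
  next
    fix Q assume "Q \<in> factorizations n \<alpha> // fact_equiv"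
    then obtain fs where fs: "fs \<in> factorizations n \<alpha>" "Q = fact_equiv `` {fs}"
      by (rule quotientE)
    have min: "min_fact ?X fs" and cnt: "\<forall>j\<ge>2. factor_count fs j = \<alpha> j"
      using fs(1) fact_iff by auto
    obtain t gs where t: "rep t ?X gs" "fs \<sim> gs"
      using min_fact_rep[OF min] by blast
    have "Node [t] \<in> trees_of_type n \<alpha>"
      using rep_tree_of_type_iff[OF t(1)] cnt factor_count_cong[OF fact_equiv_invariants(2)[OF t(2)]] by simp
    moreover have "Q = h (Node [t])"
      unfolding fs(2) h_def R_eq[OF t(1)] using equiv_class_eq[OF equiv_fact_equiv t(2)] .
    ultimately show "Q \<in> h ` trees_of_type n \<alpha>"
      by blast
  qed
  then show ?thesis
    using bij_betw_inv_into by blast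
qed

end
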